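(* Let $K, L \subset \mathbb{R}^2$ be two smooth, strictly convex planar convex bodies, each containing the origin in its interior. If $K$ and $L$ are at a dilation position, then $$E(K,L)\le \frac{V(K)}{2}\log\frac{V(L)}{V(K)},$$ where $E(K,L)$ is the curvature entropy. Equality holds if and only if $K$ and $L$ are homothetic.
   Context: A convex body in $\mathbb{R}^n$ is a compact convex subset with non-empty interior; $V$ denotes $n$-dimensional volume (area when $n=2$). The support function of $K$ is $h_K(x)=\max\{x\cdot y: y\in K\}$; when $n=2$, regard $h_K$ as a $2\pi$-periodic function of the angle $\theta$ of the unit vector $u=(\cos\theta,\sin\theta)$, with primes denoting derivatives in $\theta$. Cone-volume measure: for a convex body $K\subset\mathbb{R}^n$ containing the origin in its interior, $V_K$ is the Borel measure on the unit sphere $\mathbb{S}^{n-1}$ with $dV_K=\frac1n h_K\,dS_K$, where $S_K$ is the surface area measure of $K$. For smooth planar $K$, $dV_K=\frac12 h_K(h_K+h_K'')\,d\theta$. Its total mass is $V(K)$. Curvature entropy (planar case): $$E(K,L)=-\int_{\mathbb{S}^{1}}\log\frac{\kappa_L}{\kappa_K}\,dV_K,$$ where $\kappa_K(u)$ is the curvature of $\partial K$ at the boundary point with outer unit normal $u$, so that $1/\kappa_K=h_K+h_K''$, and hence $\frac{\kappa_L}{\kappa_K}=\frac{h_K+h_K''}{h_L+h_L''}$. The boundaries have positive curvature, so that these expressions are well defined. Dilation position: $K$ and $L$ are at a dilation position if the origin $o\in K\cap L$ and $r(K,L)\,L\subset K\subset R(K,L)\,L$, where $r(K,L)=\max\{t>0: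 x+tL\subset K \text{ for some } x\in\mathbb{R}^n\}$ and $R(K,L)=\min\{t>0: x+tL\supset K\text{ for some }x\in\mathbb{R}^n\}$. $K$ and $L$ are homothetic if $K=cL+x$ for some $c>0$ and some vector $x$. *)

theory Defs
  imports "HOL-Analysis.Analysis"
begin

subsection \<open>Convex bodies\<close>

definition convex_body :: "'a::euclidean_space set \<Rightarrow> bool" where
  "convex_body K \<longleftrightarrow> compact K \<and> convex K \<and> interior K \<noteq> {}"

definition strictly_convex :: "'a::euclidean_space set \<Rightarrow> bool" where
  "strictly_convex K \<longleftrightarrow> (\<forall>x\<in>K. \<forall>y\<in>K. x \<noteq> y \<longrightarrow> open_segment x y \<subseteq> interior K)"

definition vol :: "'a::euclidean_space set \<Rightarrow> real" where
  "vol K = measure lebesgue K"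

text \<open>For a convex body the supremum is attained, so this is the maximum.\<close>

definition support_function :: "'a::euclidean_space set \<Rightarrow> 'a \<Rightarrow> real" where
  "support_function K x = (SUP y\<in>K. x \<bullet> y)"

definition homothetic :: "'a::euclidean_space set \<Rightarrow> 'a set \<Rightarrow> bool" where
  "homothetic K L \<longleftrightarrow> (\<exists>c>0. \<exists>x. K = (\<lambda>y. c *\<^sub>R y + x) ` L)"


subsection \<open>Dilation position\<close>

text \<open>By compactness the maximum and the minimum exist whenever \<open>K\<close> and \<open>L\<close> are
  convex bodies, so \<open>Greatest\<close> and \<open>Least\<close> denote them.\<close>

definition relative_inradius :: "'a::euclidean_space set \<Rightarrow> 'a set \<Rightarrow> real" where
  "relative_inradius K L = (GREATEST t. t > 0 \<and> (\<exists>x. (\<lambda>y. x + t *\<^sub>R y) ` L \<subseteq> K))"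

definition relative_circumradius :: "'a::euclidean_space set \<Rightarrow> 'a set \<Rightarrow> real" where
  "relative_circumradius K L = (LEAST t. t > 0 \<and> (\<exists>x. K \<subseteq> (\<lambda>y. x + t *\<^sub>R y) ` L))"

definition dilation_position :: "'a::euclidean_space set \<Rightarrow> 'a set \<Rightarrow> bool" where
  "dilation_position K L \<longleftrightarrow>
     0 \<in> K \<inter> L \<and>
     (\<lambda>y. relative_inradius K L *\<^sub>R y) ` L \<subseteq> K \<and>
     K \<subseteq> (\<lambda>y. relative_circumradius K L *\<^sub>R y) ` L"


subsection \<open>Curvature of planar convex bodies\<close>

text \<open>A regular, simple closed \<open>C\<^sup>2\<close> parametrization of the boundary, extended to the
  whole line with period 1.\<close>

definition boundary_param :: "(real^2) set \<Rightarrow> (real \<Rightarrow> real^2) \<Rightarrow> bool" where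
  "boundary_param K \<gamma> \<longleftrightarrow>
     \<gamma> C1_differentiable_on UNIV \<and>
     (\<lambda>t. vector_derivative \<gamma> (at t)) C1_differentiable_on UNIV \<and>
     (\<forall>t. vector_derivative \<gamma> (at t) \<noteq> 0) \<and>
     (\<forall>t. \<gamma> (t + 1) = \<gamma> t) \<and> inj_on \<gamma> {0..<1} \<and>
     range \<gamma> = frontier K"

definition smooth_boundary :: "(real^2) set \<Rightarrow> bool" where
  "smooth_boundary K \<longleftrightarrow> (\<exists>\<gamma>. boundary_param K \<gamma>)"

text \<open>Unsigned curvature, hence independent of the orientation of the curve. The boundary
  curve of a convex body bends towards the body, so no sign information is lost there.\<close>

definition curve_curvature :: "(real \<Rightarrow> real^2) \<Rightarrow> real \<Rightarrow> real" where
  "curve_curvature \<gamma> t =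
     (let v = vector_derivative \<gamma> (at t);
          w = vector_derivative (\<lambda>s. vector_derivative \<gamma> (at s)) (at t)
      in \<bar>v$1 * w$2 - v$2 * w$1\<bar> / norm v ^ 3)"

definition positive_curvature :: "(real^2) set \<Rightarrow> bool" where
  "positive_curvature K \<longleftrightarrow> (\<forall>\<gamma> t. boundary_param K \<gamma> \<longrightarrow> curve_curvature \<gamma> t > 0)"

definition outer_normal :: "'a::euclidean_space set \<Rightarrow> 'a \<Rightarrow> 'a \<Rightarrow> bool" where
  "outer_normal K p u \<longleftrightarrow> p \<in> frontier K \<and> norm u = 1 \<and> (\<forall>y\<in>K. y \<bullet> u \<le> p \<bullet> u)"

text \<open>The curvature of the boundary at the point with outer unit normal \<open>u\<close>. This is well
  defined if \<open>K\<close> is smooth and strictly convex: the point is unique, and curvature does not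
  depend on the parametrization.\<close>

definition curvature :: "(real^2) set \<Rightarrow> real^2 \<Rightarrow> real" where
  "curvature K u =
     (THE k. \<exists>\<gamma> t. boundary_param K \<gamma> \<and> outer_normal K (\<gamma> t) u \<and> k = curve_curvature \<gamma> t)"


subsection \<open>Cone-volume measure and curvature entropy\<close>

definition unit_dir :: "real \<Rightarrow> real^2" where
  "unit_dir \<theta> = vector [cos \<theta>, sin \<theta>]"

definition support_angle :: "(real^2) set \<Rightarrow> real \<Rightarrow> real" where
  "support_angle K \<theta> = support_function K (unit_dir \<theta>)"

text \<open>The surface area measure of a planar body with twice differentiable support function
  is \<open>(h + h'') d\<theta>\<close>, here transported from the angle to the unit circle.\<close>

definition surface_area_measure :: "(real^2) set \<Rightarrow> (real^2) measure" where
  "surface_area_measure K =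
     distr (density (restrict_space lborel {0..<2*pi})
             (\<lambda>\<theta>. ennreal (support_angle K \<theta> + deriv (deriv (support_angle K)) \<theta>)))
       (restrict_space borel (sphere 0 1)) unit_dir"

definition cone_volume_measure :: "(real^2) set \<Rightarrow> (real^2) measure" where
  "cone_volume_measure K =
     density (surface_area_measure K) (\<lambda>u. ennreal (support_function K u / 2))"

definition curvature_entropy :: "(real^2) set \<Rightarrow> (real^2) set \<Rightarrow> real" where
  "curvature_entropy K L =
     - (\<integral>u. ln (curvature L u / curvature K u) \<partial>cone_volume_measure K)"

end

(* Write p, q for the support functions of K and L as functions of the angle. If r is the relative
   inradius, then p - r q is nonnegative, and maximality of r forces its zeros to meet every closed
   half circle. Wirtinger's inequality on the arcs between consecutive zeros then gives
   V(K) - 2 r V(K,L) + r^2 V(L) <= 0, and likewise for the relative circumradius R. By convexity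
   V(K) - 2 t V(K,L) + t^2 V(L) <= 0 for every value t = p/q, which lies in [r, R]. With
   s = ln t - ln(V(K)/V(L))/2 this says cosh s <= V(K,L)/sqrt(V(K) V(L)), while the integral of
   exp(-s) against the normalised cone-volume measure equals the right-hand side. Bounding the convex
   function exp(-s) by its chord shows that s has nonpositive mean (the log-Minkowski inequality),
   strictly unless r = R. Gibbs' inequality for the two cone-volume densities turns this
   into the bound on the curvature entropy. *)
theory Submission
  imports Defs
begin

subsection \<open>Wirtinger inequality and chords of the exponential\<close>

text \<open>The chord argument closes because of the normalisation. On [-a, a] with cosh a =
  V(K,L)/sqrt(V(K) V(L)) the chord of exp(-s) has constant term cosh a, which is also the mean of
  exp(-s). These cancel, and only the linear term is left. Dilation position lets one origin serve
  both ends: the contacts of K with r L and with R L are then read off from the same pair of support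
  functions. The circumradius is handled by swapping the bodies, as R(K,L) = 1/r(L,K). Equality
  forces r = R and hence K = r L; for the converse, a translation adds to h a solution of h + h'' =
  0, which no curvature sees. The definitions speak of unsigned curvature of parametrized curves, of
  a description operator and of a pushforward measure. The bridge to functions of the angle is the
  inverse of the Gauss map: positive curvature keeps the speed of the normal angle away from 0. The
  unit normal of a C^2 curve is only C^1, yet the support function is C^2, because the boundary
  point moves orthogonally to its normal.\<close>

lemma wirtinger_interval:
  fixes g g' :: "real \<Rightarrow> real"
  assumes ab: "a \<le> b" "b - a \<le> pi"
    and g: "\<And>x. (g has_real_derivative g' x) (at x)"
    and g': "continuous_on UNIV g'"
    and zero: "g a = 0" "g b = 0"
  shows "integral {a..b} (\<lambda>x. (g x)\<^sup>2) \<le> integral {a..b} (\<lambda>x. (g' x)\<^sup>2)"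
proof -
  have contg: "continuous_on S g" for S
    by (meson DERIV_continuous_on g has_field_derivative_at_within)
  have contg': "continuous_on S g'" for S
    using g' continuous_on_subset by blast
  \<comment> \<open>For \<open>b - a = pi\<close> and \<open>l = 1\<close> the tangent below has its
    poles at the endpoints. A factor \<open>l < 1\<close> keeps it finite, and \<open>l\<close>
    tends to 1 at the end.\<close>
  have ineq: "l\<^sup>2 * integral {a..b} (\<lambda>x. (g x)\<^sup>2) \<le> integral {a..b} (\<lambda>x. (g' x)\<^sup>2)"
    if l: "0 < l" "l < 1" for l :: real
  proof -
    define m where "m = (a + b) / 2"
    define T where "T = (\<lambda>x. tan (l * (x - m)))"
    have cos0: "cos (l * (x - m)) \<noteq> 0" if "x \<in> {a..b}" for x
    proof -
      have "\<bar>x - m\<bar> \<le> pi / 2"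
        using that ab unfolding m_def by (auto simp: abs_le_iff field_simps)
      then have "\<bar>l * (x - m)\<bar> \<le> l * (pi / 2)"
        using l by (simp add: abs_mult)
      also have "\<dots> < pi / 2" using l by simp
      finally have "\<bar>l * (x - m)\<bar> < pi / 2" .
      then have "cos (l * (x - m)) > 0"
        by (intro cos_gt_zero_pi) (auto simp: abs_less_iff)
      then show ?thesis by simp
    qed
    \<comment> \<open>\<open>T\<close> solves the Riccati equation T' = l (1 + T^2). The derivative
      computed here therefore completes g'^2 - l^2 g^2 to a square, and its integral is 0 because
      \<open>g\<close> vanishes at both ends.\<close>
    have der: "((\<lambda>x. l * (g x)\<^sup>2 * T x) has_real_derivative
        (2 * l * g x * g' x * T x + l\<^sup>2 * (g x)\<^sup>2 * (1 + (T x)\<^sup>2))) (at x within {a..b})"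
      if "x \<in> {a..b}" for x
    proof -
      have "(T has_real_derivative inverse ((cos (l * (x - m)))\<^sup>2) * l) (at x)"
        unfolding T_def using cos0[OF that]
        by (intro DERIV_chain2[OF DERIV_tan]) (auto intro!: derivative_eq_intros)
      also have "inverse ((cos (l * (x - m)))\<^sup>2) = 1 + (T x)\<^sup>2"
        unfolding T_def using tan_sec[OF cos0[OF that]] by (simp add: power_inverse)
      finally have T': "(T has_real_derivative (1 + (T x)\<^sup>2) * l) (at x within {a..b})"
        by (rule has_field_derivative_at_within)
      show ?thesis
        by (rule derivative_eq_intros T' has_field_derivative_at_within[OF g] refl)+
          (simp add: power2_eq_square algebra_simps)
    qed
    have "((\<lambda>x. 2 * l * g x * g' x * T x + l\<^sup>2 * (g x)\<^sup>2 * (1 + (T x)\<^sup>2)) has_integral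
        l * (g b)\<^sup>2 * T b - l * (g a)\<^sup>2 * T a) {a..b}"
      using der by (intro fundamental_theorem_of_calculus ab)
        (auto simp: has_real_derivative_iff_has_vector_derivative)
    then have i0: "((\<lambda>x. 2 * l * g x * g' x * T x + l\<^sup>2 * (g x)\<^sup>2 * (1 + (T x)\<^sup>2)) has_integral 0) {a..b}"
      using zero by simp
    have i1: "((\<lambda>x. (g' x)\<^sup>2) has_integral integral {a..b} (\<lambda>x. (g' x)\<^sup>2)) {a..b}"
      by (intro integrable_integral integrable_continuous_real continuous_intros contg')
    have i2: "((\<lambda>x. l\<^sup>2 * (g x)\<^sup>2) has_integral l\<^sup>2 * integral {a..b} (\<lambda>x. (g x)\<^sup>2)) {a..b}"
      by (intro has_integral_mult_right integrable_integral integrable_continuous_real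
            continuous_intros contg)
    have "((\<lambda>x. (g' x)\<^sup>2 - l\<^sup>2 * (g x)\<^sup>2 + (2 * l * g x * g' x * T x + l\<^sup>2 * (g x)\<^sup>2 * (1 + (T x)\<^sup>2)))
       has_integral integral {a..b} (\<lambda>x. (g' x)\<^sup>2) - l\<^sup>2 * integral {a..b} (\<lambda>x. (g x)\<^sup>2) + 0) {a..b}"
      by (intro has_integral_add has_integral_diff i0 i1 i2)
    moreover have "(g' x)\<^sup>2 - l\<^sup>2 * (g x)\<^sup>2 + (2 * l * g x * g' x * T x + l\<^sup>2 * (g x)\<^sup>2 * (1 + (T x)\<^sup>2))
        = (g' x + l * g x * T x)\<^sup>2" for x
      by (simp add: power2_eq_square algebra_simps)
    ultimately have "((\<lambda>x. (g' x + l * g x * T x)\<^sup>2) has_integral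
        integral {a..b} (\<lambda>x. (g' x)\<^sup>2) - l\<^sup>2 * integral {a..b} (\<lambda>x. (g x)\<^sup>2)) {a..b}"
      by simp
    then have "0 \<le> integral {a..b} (\<lambda>x. (g' x)\<^sup>2) - l\<^sup>2 * integral {a..b} (\<lambda>x. (g x)\<^sup>2)"
      by (rule has_integral_nonneg) simp
    then show ?thesis by simp
  qed
  have "((\<lambda>l. l\<^sup>2 * integral {a..b} (\<lambda>x. (g x)\<^sup>2)) \<longlongrightarrow> 1\<^sup>2 * integral {a..b} (\<lambda>x. (g x)\<^sup>2)) (at_left (1::real))"
    by (intro tendsto_intros)
  moreover have "\<forall>\<^sub>F l in at_left (1::real).
      l\<^sup>2 * integral {a..b} (\<lambda>x. (g x)\<^sup>2) \<le> integral {a..b} (\<lambda>x. (g' x)\<^sup>2)"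
    by (rule eventually_mono[OF eventually_at_left_real[of 0 1]]) (use ineq in auto)
  ultimately show ?thesis
    using tendsto_upperbound by fastforce
qed

lemma integral_periodic_shift:
  fixes f :: "real \<Rightarrow> real"
  assumes f: "continuous_on UNIV f" and per: "\<And>x. f (x + c) = f x" and z: "0 \<le> z" "z \<le> c"
  shows "integral {z..z + c} f = integral {0..c} f"
proof -
  have int: "f integrable_on {a..b}" for a b
    using f by (meson continuous_on_subset integrable_continuous_real subset_UNIV)
  have "integral {z..z + c} f = integral {z..c} f + integral {c..z + c} f"
    using z int by (intro Henstock_Kurzweil_Integration.integral_combine[symmetric]) auto
  also have "integral {c..z + c} f = integral {0..z} f"
    using integral_shift_Icc_real[of 0 z f c] per by (simp add: o_def add.commute)
  also have "integral {z..c} f + integral {0..z} f = integral {0..c} f"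
    using z int Henstock_Kurzweil_Integration.integral_combine[of 0 z c f] by simp
  finally show ?thesis .
qed

text \<open>There may be infinitely many zeros, so one period is cut at only three of them: some
  \<open>z0\<close>, the last zero \<open>z1\<close> up to \<open>z0 + pi\<close>, and the first
  zero \<open>z2\<close> from there on. The two outer arcs have length at most \<open>pi\<close> by
  choice. The middle arc has no zero inside, so the hypothesis on half periods bounds it as
  well.\<close>

lemma wirtinger_periodic:
  fixes g g' :: "real \<Rightarrow> real"
  assumes g: "\<And>x. (g has_real_derivative g' x) (at x)"
    and g': "continuous_on UNIV g'"
    and per: "\<And>x. g (x + 2 * pi) = g x"
    and per': "\<And>x. g' (x + 2 * pi) = g' x"
    and zero: "\<And>a. \<exists>x\<in>{a..a + pi}. g x = 0"
  shows "integral {0..2*pi} (\<lambda>x. (g x)\<^sup>2) \<le> integral {0..2*pi} (\<lambda>x. (g' x)\<^sup>2)"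
proof -
  have contg: "continuous_on S g" for S
    by (meson DERIV_continuous_on g has_field_derivative_at_within)
  have contg': "continuous_on S g'" for S
    using g' continuous_on_subset by blast
  have cl: "compact {x\<in>{a..b}. g x = 0}" for a b
  proof -
    have "closed {x\<in>{a..b}. g x = 0}"
      by (intro continuous_closed_preimage_constant contg) auto
    then have "compact ({a..b} \<inter> {x\<in>{a..b}. g x = 0})"
      by (intro compact_Int_closed) auto
    then show ?thesis by (simp add: Int_def conj_commute cong: conj_cong)
  qed
  obtain z0 where z0: "0 \<le> z0" "z0 \<le> pi" "g z0 = 0"
    using zero[of 0] by auto
  obtain z1 where z1: "z0 \<le> z1" "z1 \<le> z0 + pi" "g z1 = 0"
    and z1max: "\<And>x. x \<in> {z0..z0 + pi} \<Longrightarrow> g x = 0 \<Longrightarrow> x \<le> z1"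
  proof -
    have "{x\<in>{z0..z0 + pi}. g x = 0} \<noteq> {}" using zero[of z0] by auto
    from compact_attains_sup[OF cl this] show ?thesis using that by auto
  qed
  obtain z2 where z2: "z0 + pi \<le> z2" "z2 \<le> z0 + 2 * pi" "g z2 = 0"
    and z2min: "\<And>x. x \<in> {z0 + pi..z0 + 2 * pi} \<Longrightarrow> g x = 0 \<Longrightarrow> z2 \<le> x"
  proof -
    have "{x\<in>{z0 + pi..z0 + 2 * pi}. g x = 0} \<noteq> {}"
      using zero[of "z0 + pi"] by (auto simp: algebra_simps)
    from compact_attains_inf[OF cl this] show ?thesis using that by auto
  qed
  have "z2 - z1 \<le> pi"
  proof (rule ccontr)
    assume "\<not> z2 - z1 \<le> pi"
    then have *: "z2 - z1 > pi" by simp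
    \<comment> \<open>This centres an interval of length \<open>pi\<close> strictly between
      \<open>z1\<close> and \<open>z2\<close>.\<close>
    define m where "m = (z1 + z2 - pi) / 2"
    obtain x where x: "x \<in> {m..m + pi}" "g x = 0" using zero by blast
    with * have "z1 < x" "x < z2" unfolding m_def by (auto simp: field_simps)
    with x z1 z2 z1max[of x] z2min[of x] show False by force
  qed
  have split: "integral {0..2*pi} f = integral {z0..z1} f + integral {z1..z2} f + integral {z2..z0 + 2 * pi} f"
    if f: "continuous_on UNIV f" and per: "\<And>x. f (x + 2 * pi) = f x" for f :: "real \<Rightarrow> real"
  proof -
    have int: "f integrable_on {a..b}" for a b
      using f by (meson continuous_on_subset integrable_continuous_real subset_UNIV)
    have "integral {z0..z2} f = integral {z0..z1} f + integral {z1..z2} f"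
      using z1 z2 int by (intro Henstock_Kurzweil_Integration.integral_combine[symmetric]) auto
    moreover have "integral {z0..z0 + 2 * pi} f = integral {z0..z2} f + integral {z2..z0 + 2 * pi} f"
      using z1 z2 int by (intro Henstock_Kurzweil_Integration.integral_combine[symmetric]) auto
    moreover have "integral {z0..z0 + 2 * pi} f = integral {0..2*pi} f"
      using z0 by (intro integral_periodic_shift f per) auto
    ultimately show ?thesis by simp
  qed
  have "integral {z0..z1} (\<lambda>x. (g x)\<^sup>2) \<le> integral {z0..z1} (\<lambda>x. (g' x)\<^sup>2)"
    "integral {z1..z2} (\<lambda>x. (g x)\<^sup>2) \<le> integral {z1..z2} (\<lambda>x. (g' x)\<^sup>2)"
    "integral {z2..z0 + 2 * pi} (\<lambda>x. (g x)\<^sup>2) \<le> integral {z2..z0 + 2 * pi} (\<lambda>x. (g' x)\<^sup>2)"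
    using z0 z1 z2 \<open>z2 - z1 \<le> pi\<close> per[of z0]
    by (auto intro!: wirtinger_interval[OF _ _ g g'])
  then show ?thesis
    by (subst (1 2) split) (auto intro!: continuous_intros contg contg' simp: per per')
qed

text \<open>The right-hand side is the chord of exp(-x) over [-a, a]. The tangent at
  \<open>s\<close> lies below the values at both endpoints; weighting these two inequalities by
  \<open>a - s\<close> and \<open>a + s\<close> cancels the slope.\<close>

lemma exp_chord_less:
  fixes a s :: real
  assumes "\<bar>s\<bar> < a"
  shows "exp (- s) < cosh a - s / a * sinh a"
proof -
  have a: "a > 0" "- a < s" "s < a" using assms by auto
  have tangent: "1 + x < exp x" if "x \<noteq> 0" for x :: real
    using exp_minus_greater[of "- x"] that by simp
  have 1: "exp (- s) * (1 + (a + s)) < exp a"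
    using tangent[of "a + s"] a mult_strict_left_mono[of "1 + (a + s)" "exp (a + s)" "exp (- s)"]
    by (simp add: mult_exp_exp)
  have 2: "exp (- s) * (1 + (s - a)) < exp (- a)"
    using tangent[of "s - a"] a mult_strict_left_mono[of "1 + (s - a)" "exp (s - a)" "exp (- s)"]
    by (simp add: mult_exp_exp)
  have "(a - s) * (exp (- s) * (1 + (a + s))) + (a + s) * (exp (- s) * (1 + (s - a)))
      < (a - s) * exp a + (a + s) * exp (- a)"
    using 1 2 a by (intro add_strict_mono mult_strict_left_mono) auto
  moreover have "(a - s) * (exp (- s) * (1 + (a + s))) + (a + s) * (exp (- s) * (1 + (s - a)))
      = 2 * a * exp (- s)" by (simp add: algebra_simps)
  ultimately show ?thesis using a
    by (simp add: cosh_def sinh_def field_simps)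
qed

lemma exp_chord_le:
  fixes a s :: real
  assumes "\<bar>s\<bar> \<le> a" "0 < a"
  shows "exp (- s) \<le> cosh a - s / a * sinh a"
proof (cases "\<bar>s\<bar> < a")
  case False
  then have "s = a \<or> s = - a" using assms by auto
  then show ?thesis using assms by (auto simp: cosh_def sinh_def field_simps)
qed (use exp_chord_less in force)

subsection \<open>Support functions on the circle\<close>

lemma integral_nonneg_pos:
  fixes f :: "real \<Rightarrow> real"
  assumes "continuous_on {a..b} f" "a < b" "\<And>x. x \<in> {a..b} \<Longrightarrow> 0 \<le> f x"
    and "z \<in> {a..b}" "0 < f z"
  shows "0 < integral {a..b} f"
proof -
  have "0 \<le> integral {a..b} f"
    using assms by (intro integral_nonneg integrable_continuous_real) auto
  moreover have "integral {a..b} f \<noteq> 0"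
    using assms integral_eq_0_iff[of a b f] by force
  ultimately show ?thesis by simp
qed

lemma periodic_derivative:
  fixes f f' :: "real \<Rightarrow> real"
  assumes "\<And>x. (f has_real_derivative f' x) (at x)" and "\<And>x. f (x + c) = f x"
  shows "f' (x + c) = f' x"
proof -
  have "((\<lambda>x. f (x + c)) has_real_derivative f' (x + c)) (at x)"
    using assms(1)[of "x + c"] by (simp add: DERIV_shift)
  then have "(f has_real_derivative f' (x + c)) (at x)"
    by (simp add: assms(2))
  then show ?thesis using assms(1) DERIV_unique by blast
qed

text \<open>The angular data of a body: \<open>h\<close> is the support function, \<open>h1\<close>
  and \<open>h2\<close> are its derivatives, \<open>h + h2\<close> is the radius of curvature. The
  inequalities are proved for such functions, apart from any body.\<close>

locale smooth_support =
  fixes h h1 h2 :: "real \<Rightarrow> real"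
  assumes DERIV_h: "\<And>x. (h has_real_derivative h1 x) (at x)"
    and DERIV_h1: "\<And>x. (h1 has_real_derivative h2 x) (at x)"
    and continuous_h2: "continuous_on UNIV h2"
    and periodic_h: "\<And>x. h (x + 2 * pi) = h x"
    and h_pos: "\<And>x. 0 < h x"
    and radius_pos: "\<And>x. 0 < h x + h2 x"
begin

lemma periodic_h1: "h1 (x + 2 * pi) = h1 x"
  using periodic_derivative DERIV_h periodic_h by blast

lemma periodic_h2: "h2 (x + 2 * pi) = h2 x"
  using periodic_derivative DERIV_h1 periodic_h1 by blast

lemma continuous [continuous_intros]:
  "continuous_on S h" "continuous_on S h1" "continuous_on S h2"
proof -
  show "continuous_on S h" "continuous_on S h1"
    by (rule DERIV_continuous_on, rule has_field_derivative_at_within, rule DERIV_h DERIV_h1)+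
  show "continuous_on S h2"
    using continuous_h2 by (rule continuous_on_subset) simp
qed

end

section \<open>Mixed area and the Bonnesen inequality\<close>

text \<open>The planar mixed volume V(K,L), integrated by parts: this form is visibly symmetric and
  contains only first derivatives, as Wirtinger's inequality does.\<close>

definition mixed_area :: "(real \<Rightarrow> real) \<Rightarrow> (real \<Rightarrow> real) \<Rightarrow> (real \<Rightarrow> real) \<Rightarrow> (real \<Rightarrow> real) \<Rightarrow> real" where
  "mixed_area p p1 q q1 = integral {0..2*pi} (\<lambda>x. p x * q x - p1 x * q1 x) / 2"

lemma mixed_area_commute: "mixed_area p p1 q q1 = mixed_area q q1 p p1"
  unfolding mixed_area_def by (simp add: mult.commute)

locale smooth_support_pair = p: smooth_support p p1 p2 + q: smooth_support q q1 q2
  for p p1 p2 q q1 q2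
begin

lemmas continuous = p.continuous q.continuous

text \<open>Integration by parts over a full period leaves no boundary term. For equal arguments the
  integrand is the density of the cone-volume measure.\<close>

lemma has_integral_mixed:
  "((\<lambda>x. p x * (q x + q2 x) / 2) has_integral mixed_area p p1 q q1) {0..2*pi}"
proof -
  have "((\<lambda>x. p1 x * q1 x + p x * q2 x) has_integral p (2*pi) * q1 (2*pi) - p 0 * q1 0) {0..2*pi}"
  proof (rule fundamental_theorem_of_calculus)
    fix x assume "x \<in> {0..2*pi}"
    have "((\<lambda>x. p x * q1 x) has_real_derivative p1 x * q1 x + q2 x * p x) (at x)"
      by (rule DERIV_mult[OF p.DERIV_h q.DERIV_h1])
    then show "((\<lambda>x. p x * q1 x) has_vector_derivative p1 x * q1 x + p x * q2 x) (at x within {0..2*pi})"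
      by (simp add: has_real_derivative_iff_has_vector_derivative has_vector_derivative_at_within mult.commute)
  qed simp
  then have "((\<lambda>x. p1 x * q1 x + p x * q2 x) has_integral 0) {0..2*pi}"
    using p.periodic_h[of 0] q.periodic_h1[of 0] by simp
  moreover have "((\<lambda>x. p x * q x - p1 x * q1 x) has_integral 2 * mixed_area p p1 q q1) {0..2*pi}"
    unfolding mixed_area_def
    by (simp add: integrable_integral integrable_continuous_real continuous_intros continuous)
  ultimately have "((\<lambda>x. (p x * q x - p1 x * q1 x) + (p1 x * q1 x + p x * q2 x)) has_integral
      2 * mixed_area p p1 q q1 + 0) {0..2*pi}"
    by (rule has_integral_add[rotated])
  then have "((\<lambda>x. 1 / 2 * ((p x * q x - p1 x * q1 x) + (p1 x * q1 x + p x * q2 x))) has_integral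
      1 / 2 * (2 * mixed_area p p1 q q1 + 0)) {0..2*pi}"
    by (rule has_integral_mult_right)
  moreover have eq: "1 / 2 * ((p x * q x - p1 x * q1 x) + (p1 x * q1 x + p x * q2 x)) = p x * (q x + q2 x) / 2" for x
    by (simp add: algebra_simps)
  ultimately show ?thesis unfolding eq by simp
qed

lemma mixed_area_pos: "0 < mixed_area p p1 q q1"
proof -
  have "0 < integral {0..2*pi} (\<lambda>x. p x * (q x + q2 x) / 2)"
    by (intro integral_nonneg_pos[of _ _ _ 0] continuous_intros continuous)
      (simp_all add: p.h_pos q.radius_pos less_imp_le)
  then show ?thesis unfolding integral_unique[OF has_integral_mixed] .
qed

text \<open>The quadratic form is minus the Wirtinger deficit of \<open>p - t * q\<close>.\<close>

lemma bonnesen_contact: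
  assumes "\<And>a. \<exists>x\<in>{a..a + pi}. p x = t * q x"
  shows "mixed_area p p1 p p1 - 2 * t * mixed_area p p1 q q1 + t\<^sup>2 * mixed_area q q1 q q1 \<le> 0"
proof -
  let ?I = "integral {0..2*pi}"
  define g where "g = (\<lambda>x. p x - t * q x)"
  define g' where "g' = (\<lambda>x. p1 x - t * q1 x)"
  have "?I (\<lambda>x. (g x)\<^sup>2) \<le> ?I (\<lambda>x. (g' x)\<^sup>2)"
  proof (rule wirtinger_periodic)
    show "(g has_real_derivative g' x) (at x)" for x
      unfolding g_def g'_def
      by (auto intro!: derivative_eq_intros p.DERIV_h q.DERIV_h)
    show "\<exists>x\<in>{a..a + pi}. g x = 0" for a using assms[of a] by (auto simp: g_def)
  qed (auto simp: g_def g'_def p.periodic_h q.periodic_h p.periodic_h1 q.periodic_h1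
      intro!: continuous_intros continuous)
  moreover have "(\<lambda>x. (g x)\<^sup>2) integrable_on {0..2*pi}" "(\<lambda>x. (g' x)\<^sup>2) integrable_on {0..2*pi}"
    by (auto simp: g_def g'_def intro!: integrable_continuous_real continuous_intros continuous)
  ultimately have le: "?I (\<lambda>x. (g x)\<^sup>2 - (g' x)\<^sup>2) \<le> 0"
    by (simp add: integral_diff)
  have eq: "(g x)\<^sup>2 - (g' x)\<^sup>2 = (p x * p x - p1 x * p1 x) - (2 * t) * (p x * q x - p1 x * q1 x)
      + t\<^sup>2 * (q x * q x - q1 x * q1 x)" for x
    by (simp add: g_def g'_def power2_eq_square algebra_simps)
  have mixed: "((\<lambda>x. f x * h x - f' x * h' x) has_integral 2 * mixed_area f f' h h') {0..2*pi}"
    if "continuous_on {0..2*pi} f" "continuous_on {0..2*pi} f'" "continuous_on {0..2*pi} h" "continuous_on {0..2*pi} h'"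
    for f f' h h'
    unfolding mixed_area_def using that
    by (simp add: integrable_integral integrable_continuous_real continuous_intros)
  have "((\<lambda>x. (g x)\<^sup>2 - (g' x)\<^sup>2) has_integral 2 * mixed_area p p1 p p1
      - (2 * t) * (2 * mixed_area p p1 q q1) + t\<^sup>2 * (2 * mixed_area q q1 q q1)) {0..2*pi}"
    unfolding eq by (intro has_integral_add has_integral_diff has_integral_mult_right mixed continuous)
  then show ?thesis using le by (simp add: integral_unique)
qed

end

lemma convex_quadratic_nonpos:
  fixes A W B r R t :: real
  assumes "A - 2 * r * W + r\<^sup>2 * B \<le> 0" "A - 2 * R * W + R\<^sup>2 * B \<le> 0" "0 < B"
  shows "r \<le> t \<Longrightarrow> t \<le> R \<Longrightarrow> A - 2 * t * W + t\<^sup>2 * B \<le> 0"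
    and "r < t \<Longrightarrow> t < R \<Longrightarrow> A - 2 * t * W + t\<^sup>2 * B < 0"
proof -
  \<comment> \<open>Linear interpolation of the quadratic between \<open>r\<close> and
    \<open>R\<close> with its exact error term; that term supplies the strictness in the
    interior.\<close>
  have eq: "(R - r) * (A - 2 * t * W + t\<^sup>2 * B) = (R - t) * (A - 2 * r * W + r\<^sup>2 * B)
      + (t - r) * (A - 2 * R * W + R\<^sup>2 * B) - B * ((R - r) * (R - t) * (t - r))"
    by (simp add: power2_eq_square algebra_simps)
  show "A - 2 * t * W + t\<^sup>2 * B < 0" if "r < t" "t < R"
  proof -
    have "(R - t) * (A - 2 * r * W + r\<^sup>2 * B) \<le> 0" "(t - r) * (A - 2 * R * W + R\<^sup>2 * B) \<le> 0"
      "0 < B * ((R - r) * (R - t) * (t - r))"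
      using that assms by (auto simp: mult_le_0_iff)
    then have "(R - r) * (A - 2 * t * W + t\<^sup>2 * B) < 0" using eq by linarith
    then show ?thesis using that by (simp add: mult_less_0_iff)
  qed
  then show "A - 2 * t * W + t\<^sup>2 * B \<le> 0" if "r \<le> t" "t \<le> R"
    using that assms by (cases "t = r \<or> t = R") force+
qed

section \<open>Log-Minkowski inequality and entropy bound\<close>

context smooth_support_pair
begin

theorem log_minkowski:
  fixes r R
  defines "A \<equiv> mixed_area p p1 p p1" and "B \<equiv> mixed_area q q1 q q1"
  assumes r: "0 < r" and bounds: "\<And>x. r * q x \<le> p x" "\<And>x. p x \<le> R * q x"
    and contact: "\<And>a. \<exists>x\<in>{a..a + pi}. p x = r * q x" "\<And>a. \<exists>x\<in>{a..a + pi}. p x = R * q x"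
  shows "integral {0..2*pi} (\<lambda>x. ln (p x / q x) * (p x * (p x + p2 x) / 2)) \<le> A / 2 * ln (A / B)"
    and "r < R \<Longrightarrow> integral {0..2*pi} (\<lambda>x. ln (p x / q x) * (p x * (p x + p2 x) / 2)) < A / 2 * ln (A / B)"
proof -
  let ?I = "integral {0..2*pi}"
  interpret pp: smooth_support_pair p p1 p2 p p1 p2 by unfold_locales
  interpret qq: smooth_support_pair q q1 q2 q q1 q2 by unfold_locales
  interpret qp: smooth_support_pair q q1 q2 p p1 p2 by unfold_locales
  define W where "W = mixed_area p p1 q q1"
  have AB: "0 < A" "0 < B" using pp.mixed_area_pos qq.mixed_area_pos by (auto simp: A_def B_def)
  have quad_r: "A - 2 * r * W + r\<^sup>2 * B \<le> 0" and quad_R: "A - 2 * R * W + R\<^sup>2 * B \<le> 0"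
    using bonnesen_contact contact by (auto simp: A_def B_def W_def)
  define t where "t = (\<lambda>x. p x / q x)"
  have ne: "q x \<noteq> 0" for x using q.h_pos[of x] by simp
  have t: "r \<le> t x" "t x \<le> R" "0 < t x" for x
    using bounds[of x] p.h_pos[of x] q.h_pos[of x] by (auto simp: t_def field_simps)
  have t_ne: "t x \<noteq> 0" for x using t(3)[of x] by simp
  \<comment> \<open>Dividing by \<open>k\<close> rescales the two bodies to equal area, which
    centres the range allowed for \<open>s\<close> at 0.\<close>
  define k where "k = sqrt (A / B)"
  have k: "0 < k" "k * k = A / B" using AB by (auto simp: k_def)
  \<comment> \<open>As \<open>k * B\<close> is sqrt (A B), this is V(K,L)/sqrt(V(K) V(L)).\<close>
  define c where "c = W / (k * B)"
  define s where "s = (\<lambda>x. ln (t x / k))"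
  \<comment> \<open>The quadratic, divided by 2 t k B, is exactly cosh s - c, so its sign is a bound
    on \<bar>s\<bar>.\<close>
  have cosh_s: "cosh (s x) = c + (A - 2 * t x * W + (t x)\<^sup>2 * B) / (2 * t x * k * B)" for x
  proof -
    have "k \<noteq> 0" "t x \<noteq> 0" "B \<noteq> 0" "A = k * k * B" using AB t[of x] k by auto
    then show ?thesis using k t[of x]
      by (simp add: s_def c_def cosh_ln_real field_simps power2_eq_square)
  qed
  have cosh_le: "cosh (s x) \<le> c" for x
    unfolding cosh_s using convex_quadratic_nonpos(1)[OF quad_r quad_R AB(2) t(1,2)[of x]] AB k t[of x]
    by (simp add: divide_nonpos_pos)
  have cosh_less: "cosh (s x) < c" if "r < t x" "t x < R" for x
    unfolding cosh_s using convex_quadratic_nonpos(2)[OF quad_r quad_R AB(2) that] AB k t[of x]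
    by (simp add: divide_neg_pos)
  \<comment> \<open>This is Minkowski's inequality W^2 \<ge> A B; it makes \<open>arcosh c\<close>
    meaningful.\<close>
  have c1: "1 \<le> c" using cosh_le[of 0] cosh_real_ge_1[of "s 0"] by linarith
  define a where "a = arcosh c"
  have a: "0 \<le> a" "cosh a = c" using c1 by (auto simp: a_def)
  have abs_s: "\<bar>s x\<bar> \<le> a" for x
    using cosh_le[of x] a cosh_real_nonneg_le_iff[of "\<bar>s x\<bar>" a] by simp
  have abs_s': "\<bar>s x\<bar> < a" if "r < t x" "t x < R" for x
    using cosh_less[OF that] a cosh_real_nonneg_less_iff[of "\<bar>s x\<bar>" a] by simp
  define w where "w = (\<lambda>x. p x * (p x + p2 x) / 2)"
  have w: "0 < w x" for x using p.h_pos p.radius_pos by (simp add: w_def)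
  have cont_t: "continuous_on S t" for S
    unfolding t_def by (intro continuous_intros continuous) (simp add: ne)
  have cont_s: "continuous_on S s" for S
    unfolding s_def using k t(3) by (intro continuous_intros cont_t) (simp_all add: t_ne)
  have cont_w: "continuous_on S w" for S
    unfolding w_def by (intro continuous_intros continuous) auto
  have int_w: "(w has_integral A) {0..2*pi}"
    unfolding w_def A_def by (rule pp.has_integral_mixed)
  have int_sw: "((\<lambda>x. s x * w x) has_integral ?I (\<lambda>x. s x * w x)) {0..2*pi}"
    by (intro integrable_integral integrable_continuous_real continuous_intros cont_s cont_w)
  have "ln (t x) * w x = s x * w x + ln k * w x" for x
    using t(3)[of x] k by (simp add: s_def ln_div algebra_simps)
  then have "((\<lambda>x. ln (t x) * w x) has_integral ?I (\<lambda>x. s x * w x) + ln k * A) {0..2*pi}"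
    using has_integral_add[OF int_sw has_integral_mult_right[OF int_w, of "ln k"]] by simp
  moreover have "ln k * A = A / 2 * ln (A / B)"
    unfolding k_def using AB by (simp add: ln_sqrt)
  ultimately have "?I (\<lambda>x. ln (t x) * w x) = ?I (\<lambda>x. s x * w x) + A / 2 * ln (A / B)"
    by (simp only: integral_unique)
  then have I_eq: "?I (\<lambda>x. ln (p x / q x) * (p x * (p x + p2 x) / 2)) = ?I (\<lambda>x. s x * w x) + A / 2 * ln (A / B)"
    by (simp only: t_def w_def)
  have main: "?I (\<lambda>x. s x * w x) \<le> 0 \<and> (r < R \<longrightarrow> ?I (\<lambda>x. s x * w x) < 0)"
  proof -
    \<comment> \<open>Both extreme ratios are attained, so for \<open>r < R\<close> the intermediate
      value theorem yields a ratio strictly between them.\<close>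
    have ex: "\<exists>z\<in>{0..2*pi}. \<bar>s z\<bar> < a" if rR: "r < R"
    proof -
      obtain x0 where x0: "x0 \<in> {0..pi}" "t x0 = r"
        using contact(1)[of 0] by (auto simp: t_def ne)
      obtain x1 where x1: "x1 \<in> {0..pi}" "t x1 = R"
        using contact(2)[of 0] by (auto simp: t_def ne)
      have "connected (t ` {0..pi})" by (intro connected_continuous_image cont_t) auto
      then have "(r + R) / 2 \<in> t ` {0..pi}"
        by (rule connectedD_interval[of _ r R]) (use rR x0 x1 in auto)
      then obtain z where "z \<in> {0..pi}" "t z = (r + R) / 2" by force
      then show ?thesis using abs_s'[of z] rR by (intro bexI[of _ z]) auto
    qed
    show ?thesis
    \<comment> \<open>For \<open>a = 0\<close> there is no chord to divide by; then \<open>s\<close>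
      vanishes identically and \<open>ex\<close> excludes \<open>r < R\<close>.\<close>
    proof (cases "a = 0")
      case True
      then have "s x = 0" for x using abs_s[of x] by simp
      then show ?thesis using True ex by auto
    next
      case False
      then have a0: "0 < a" using a by simp
      \<comment> \<open>The gap between chord and exponential, weighted by the cone-volume density
        of the first body.\<close>
      define D where "D = (\<lambda>x. (cosh a - s x / a * sinh a - exp (- s x)) * w x)"
      \<comment> \<open>Since exp(-s) = k q / p, the weight \<open>p\<close> is traded for
        \<open>q\<close>, and the density of the mixed area appears.\<close>
      have exp_w: "exp (- s x) * w x = k * (q x * (p x + p2 x) / 2)" for x
        using k t(3)[of x] p.h_pos[of x] q.h_pos[of x]
        by (simp add: s_def exp_minus t_def w_def field_simps)
      have "((\<lambda>x. exp (- s x) * w x) has_integral k * W) {0..2*pi}"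
        unfolding exp_w W_def mixed_area_commute[of p]
        by (intro has_integral_mult_right qp.has_integral_mixed)
      moreover have "((\<lambda>x. sinh a / a * (s x * w x)) has_integral sinh a / a * ?I (\<lambda>x. s x * w x)) {0..2*pi}"
        by (rule has_integral_mult_right[OF int_sw])
      moreover have "((\<lambda>x. c * w x) has_integral c * A) {0..2*pi}"
        by (rule has_integral_mult_right[OF int_w])
      ultimately have "((\<lambda>x. c * w x - sinh a / a * (s x * w x) - exp (- s x) * w x) has_integral
          (c * A - sinh a / a * ?I (\<lambda>x. s x * w x) - k * W)) {0..2*pi}"
        by (intro has_integral_diff)
      \<comment> \<open>Here the constant term of the chord meets the integral of exp(-s). After
        they cancel, the integral of \<open>D\<close> is a negative multiple of the integral of
        \<open>s * w\<close>.\<close>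
      moreover have "c * A = k * W" unfolding c_def using k AB by (simp add: field_simps)
      ultimately have D: "(D has_integral - (sinh a / a * ?I (\<lambda>x. s x * w x))) {0..2*pi}"
        unfolding D_def a by (simp add: algebra_simps)
      have D_nonneg: "0 \<le> D x" for x
        unfolding D_def using exp_chord_le[OF abs_s a0] w[of x] by simp
      have D_pos: "0 < D x" if "\<bar>s x\<bar> < a" for x
        unfolding D_def using exp_chord_less[OF that] w[of x] by simp
      have cont_D: "continuous_on {0..2*pi} D"
        unfolding D_def using a0 by (intro continuous_intros cont_s cont_w) auto
      have sinh: "0 < sinh a / a" using a0 by simp
      have "0 \<le> - (sinh a / a * ?I (\<lambda>x. s x * w x))"
        using has_integral_nonneg[OF D] D_nonneg by blast
      moreover have "0 < - (sinh a / a * ?I (\<lambda>x. s x * w x))" if rR: "r < R"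
      proof -
        obtain z where "z \<in> {0..2*pi}" "0 < D z" using ex[OF rR] D_pos by blast
        then have "0 < integral {0..2*pi} D"
          using D_nonneg by (intro integral_nonneg_pos[OF cont_D]) auto
        then show ?thesis unfolding integral_unique[OF D] .
      qed
      ultimately show ?thesis
        using mult_le_cancel_left_pos[OF sinh, of "?I (\<lambda>x. s x * w x)" 0]
          mult_less_cancel_left_pos[OF sinh, of "?I (\<lambda>x. s x * w x)" 0] by linarith
    qed
  qed
  then show "?I (\<lambda>x. ln (p x / q x) * (p x * (p x + p2 x) / 2)) \<le> A / 2 * ln (A / B)"
    and "r < R \<Longrightarrow> ?I (\<lambda>x. ln (p x / q x) * (p x * (p x + p2 x) / 2)) < A / 2 * ln (A / B)"
    unfolding I_eq by simp_all
qed

text \<open>Apply ln y \<le> y - 1 to the ratio of the two normalised cone-volume densities and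
  integrate. Both densities get the mass \<open>A\<close>, so y - 1 contributes nothing.\<close>

lemma gibbs:
  defines "A \<equiv> mixed_area p p1 p p1" and "B \<equiv> mixed_area q q1 q q1"
  shows "integral {0..2*pi} (\<lambda>x. ln ((q x + q2 x) / (p x + p2 x)) * (p x * (p x + p2 x) / 2))
    \<le> integral {0..2*pi} (\<lambda>x. ln (p x / q x) * (p x * (p x + p2 x) / 2)) - A * ln (A / B)"
proof -
  let ?I = "integral {0..2*pi}"
  interpret pp: smooth_support_pair p p1 p2 p p1 p2 by unfold_locales
  interpret qq: smooth_support_pair q q1 q2 q q1 q2 by unfold_locales
  have AB: "0 < A" "0 < B" using pp.mixed_area_pos qq.mixed_area_pos by (auto simp: A_def B_def)
  define w where "w = (\<lambda>x. p x * (p x + p2 x) / 2)"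
  have w: "0 < w x" for x using p.h_pos p.radius_pos by (simp add: w_def)
  have ne: "p x \<noteq> 0" "q x \<noteq> 0" "p x + p2 x \<noteq> 0" "q x + q2 x \<noteq> 0" for x
    using p.h_pos[of x] q.h_pos[of x] p.radius_pos[of x] q.radius_pos[of x] by auto
  have int_w: "(w has_integral A) {0..2*pi}"
    unfolding w_def A_def by (rule pp.has_integral_mixed)
  have i1: "((\<lambda>x. ln ((q x + q2 x) / (p x + p2 x)) * w x) has_integral ?I (\<lambda>x. ln ((q x + q2 x) / (p x + p2 x)) * w x)) {0..2*pi}"
    and i2: "((\<lambda>x. ln (p x / q x) * w x) has_integral ?I (\<lambda>x. ln (p x / q x) * w x)) {0..2*pi}"
    unfolding w_def using ne
    by (intro integrable_integral integrable_continuous_real continuous_intros continuous; simp)+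
  have i3: "((\<lambda>x. A / B * (q x * (q x + q2 x) / 2)) has_integral A / B * B) {0..2*pi}"
    unfolding B_def by (intro has_integral_mult_right qq.has_integral_mixed)
  have "ln ((q x + q2 x) / (p x + p2 x)) * w x - ln (p x / q x) * w x + ln (A / B) * w x
      \<le> A / B * (q x * (q x + q2 x) / 2) - w x" for x
  proof -
    \<comment> \<open>This is (q (q + q2) / B) / (p (p + p2) / A), arranged so that its logarithm
      splits into the entropy integrand, the log-Minkowski integrand and a constant.\<close>
    define y where "y = (q x + q2 x) / (p x + p2 x) / (p x / q x) * (A / B)"
    have y: "0 < y" "ln y = ln ((q x + q2 x) / (p x + p2 x)) - ln (p x / q x) + ln (A / B)"
      using AB p.h_pos[of x] q.h_pos[of x] p.radius_pos[of x] q.radius_pos[of x]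
      by (auto simp: y_def ln_mult ln_div)
    have y_w: "y * w x = A / B * (q x * (q x + q2 x) / 2)"
      using AB ne[of x] by (simp add: y_def w_def)
    have "ln ((q x + q2 x) / (p x + p2 x)) * w x - ln (p x / q x) * w x + ln (A / B) * w x = ln y * w x"
      by (simp only: y(2) algebra_simps)
    also have "\<dots> \<le> (y - 1) * w x"
      by (intro mult_right_mono ln_le_minus_one y less_imp_le w)
    also have "\<dots> = A / B * (q x * (q x + q2 x) / 2) - w x"
      by (simp only: y_w left_diff_distrib mult_1_left)
    finally show ?thesis .
  qed
  from has_integral_le[OF has_integral_add[OF has_integral_diff[OF i1 i2] has_integral_mult_right[OF int_w, of "ln (A / B)"]]
      has_integral_diff[OF i3 int_w] this]
  show ?thesis using AB by (simp add: w_def algebra_simps)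
qed

text \<open>Gibbs contributes -A ln (A/B) and log-Minkowski adds at most half of A ln (A/B). The
  strict version takes its strictness from \<open>log_minkowski\<close>.\<close>

theorem entropy_bound:
  fixes r R
  defines "A \<equiv> mixed_area p p1 p p1" and "B \<equiv> mixed_area q q1 q q1"
    and "E \<equiv> integral {0..2*pi} (\<lambda>x. ln ((q x + q2 x) / (p x + p2 x)) * (p x * (p x + p2 x) / 2))"
  assumes "0 < r" "\<And>x. r * q x \<le> p x" "\<And>x. p x \<le> R * q x"
    and "\<And>a. \<exists>x\<in>{a..a + pi}. p x = r * q x" "\<And>a. \<exists>x\<in>{a..a + pi}. p x = R * q x"
  shows "E \<le> A / 2 * ln (B / A)" and "r < R \<Longrightarrow> E < A / 2 * ln (B / A)"
proof -
  interpret pp: smooth_support_pair p p1 p2 p p1 p2 by unfold_locales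
  interpret qq: smooth_support_pair q q1 q2 q q1 q2 by unfold_locales
  have "0 < A" "0 < B" using pp.mixed_area_pos qq.mixed_area_pos by (auto simp: A_def B_def)
  then have eq: "A / 2 * ln (B / A) = A / 2 * ln (A / B) - A * ln (A / B)"
    by (simp add: ln_div algebra_simps) (simp add: field_simps)
  let ?J = "integral {0..2*pi} (\<lambda>x. ln (p x / q x) * (p x * (p x + p2 x) / 2))"
  have "E \<le> ?J - A * ln (A / B)"
    unfolding E_def A_def B_def by (rule gibbs)
  moreover have "?J \<le> A / 2 * ln (A / B)"
    unfolding A_def B_def by (rule log_minkowski(1)[OF assms(4-8)])
  moreover have "?J < A / 2 * ln (A / B)" if "r < R"
    unfolding A_def B_def by (rule log_minkowski(2)[OF assms(4-8) that])
  ultimately show "E \<le> A / 2 * ln (B / A)" and "r < R \<Longrightarrow> E < A / 2 * ln (B / A)"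
    unfolding eq by linarith+
qed

end

subsection \<open>Support functions of smooth planar bodies\<close>

definition rot90 :: "real^2 \<Rightarrow> real^2" where
  "rot90 v = vector [- v $ 2, v $ 1]"

lemma rot90_nth [simp]: "rot90 v $ 1 = - v $ 2" "rot90 v $ 2 = v $ 1"
  by (simp_all add: rot90_def)

lemma unit_dir_nth [simp]: "unit_dir a $ 1 = cos a" "unit_dir a $ 2 = sin a"
  by (simp_all add: unit_dir_def)

lemma inner_2: "(v::real^2) \<bullet> w = v $ 1 * w $ 1 + v $ 2 * w $ 2"
  by (simp add: inner_vec_def sum_2)

lemma rot90_rot90 [simp]: "rot90 (rot90 v) = - v"
  by (simp add: vec_eq_iff forall_2)

lemma inner_rot90_rot90 [simp]: "rot90 v \<bullet> rot90 w = v \<bullet> w"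
  by (simp add: inner_2)

lemma inner_rot90_self [simp]: "rot90 v \<bullet> v = 0" "v \<bullet> rot90 v = 0"
  by (simp_all add: inner_2)

lemma norm_rot90 [simp]: "norm (rot90 v) = norm v"
  by (simp add: norm_eq_sqrt_inner)

lemma linear_rot90: "linear rot90"
  by (rule linearI) (simp_all add: vec_eq_iff forall_2)

lemmas bounded_linear_rot90 = linear_conv_bounded_linear[THEN iffD1, OF linear_rot90]
lemmas rot90_scaleR [simp] = linear_scale[OF linear_rot90]
lemmas rot90_minus [simp] = linear_neg[OF linear_rot90]

lemma norm_unit_dir [simp]: "norm (unit_dir a) = 1"
  by (simp add: norm_eq_sqrt_inner inner_2 power2_eq_square[symmetric])

lemma inner_unit_dir_self [simp]: "unit_dir a \<bullet> unit_dir a = 1"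
  by (simp add: inner_2 power2_eq_square[symmetric])

lemma unit_dir_periodic [simp]: "unit_dir (a + 2 * pi) = unit_dir a"
  by (simp add: vec_eq_iff forall_2)

lemma norm_1_unit_dir: "norm (u::real^2) = 1 \<Longrightarrow> \<exists>a. u = unit_dir a"
proof -
  assume "norm u = 1"
  then have "(u $ 1)\<^sup>2 + (u $ 2)\<^sup>2 = 1" by (simp add: norm_eq_1 inner_2 power2_eq_square)
  then obtain a where "u $ 1 = cos a" "u $ 2 = sin a" using sincos_total_2pi by blast
  then show ?thesis by (auto simp: vec_eq_iff forall_2)
qed

lemma plane_decomposition:
  assumes "norm u = 1"
  shows "x = (x \<bullet> u) *\<^sub>R u + (x \<bullet> rot90 u) *\<^sub>R rot90 u"
proof -
  obtain a where u: "u = unit_dir a" using assms norm_1_unit_dir by blast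
  have "x $ 1 * cos a * cos a + x $ 1 * sin a * sin a = x $ 1"
    "x $ 2 * cos a * cos a + x $ 2 * sin a * sin a = x $ 2"
    by (simp_all only: mult.assoc distrib_left[symmetric] power2_eq_square[symmetric] sin_cos_squared_add2 mult_1_right)
  then show ?thesis by (simp add: u vec_eq_iff forall_2 inner_2 algebra_simps)
qed

lemma unit_dir_eq_iff: "unit_dir a = unit_dir b \<longleftrightarrow> (\<exists>k::int. a = b + 2 * pi * k)"
proof -
  have "unit_dir a = unit_dir b \<longleftrightarrow> sin a = sin b \<and> cos a = cos b"
    by (auto simp: vec_eq_iff forall_2)
  then show ?thesis by (simp only: sin_cos_eq_iff)
qed

lemma unit_dir_inj: "inj_on unit_dir {0..<2*pi}"
proof (rule inj_onI)
  fix a b assume ab: "a \<in> {0..<2*pi}" "b \<in> {0..<2*pi}" "unit_dir a = unit_dir b"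
  then obtain k :: int where k: "a = b + 2 * pi * k" using unit_dir_eq_iff by blast
  have e: "a - b = 2 * pi * real_of_int k" using k by simp
  have "2 * pi * (- 1) < a - b" "a - b < 2 * pi * 1"
    using ab(1,2) by auto
  then have "- 1 < real_of_int k" "real_of_int k < 1"
    unfolding e by (simp_all only: mult_less_cancel_left_pos pi_gt_zero mult_pos_pos zero_less_numeral)
  then have "k = 0" by linarith
  then show "a = b" using k by simp
qed

text \<open>This form gives access to the derivative and continuity rules for \<open>scaleR\<close>,
  which do not see through \<open>vector\<close>.\<close>

lemma unit_dir_conv: "unit_dir a = cos a *\<^sub>R unit_dir 0 + sin a *\<^sub>R rot90 (unit_dir 0)"
  by (simp add: vec_eq_iff forall_2)

lemma unit_dir_has_vector_derivative [derivative_intros]: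
  assumes "(f has_real_derivative f') (at x within S)"
  shows "((\<lambda>x. unit_dir (f x)) has_vector_derivative f' *\<^sub>R rot90 (unit_dir (f x))) (at x within S)"
proof -
  have "((\<lambda>x. cos (f x) *\<^sub>R unit_dir 0 + sin (f x) *\<^sub>R rot90 (unit_dir 0)) has_vector_derivative
      (f' * - sin (f x)) *\<^sub>R unit_dir 0 + (f' * cos (f x)) *\<^sub>R rot90 (unit_dir 0)) (at x within S)"
    by (auto intro!: derivative_eq_intros assms simp: mult.commute)
  moreover have "(f' * - sin (f x)) *\<^sub>R unit_dir 0 + (f' * cos (f x)) *\<^sub>R rot90 (unit_dir 0)
      = f' *\<^sub>R rot90 (unit_dir (f x))"
    by (simp add: vec_eq_iff forall_2)
  ultimately show ?thesis by (simp add: unit_dir_conv[symmetric])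
qed

lemma unit_dir_deriv: "(unit_dir has_vector_derivative rot90 (unit_dir a)) (at a)"
  using unit_dir_has_vector_derivative[of "\<lambda>x. x" 1 a] by simp

lemma rot90_unit_dir_deriv: "((\<lambda>a. rot90 (unit_dir a)) has_vector_derivative - unit_dir a) (at a)"
  using bounded_linear.has_vector_derivative[OF bounded_linear_rot90 unit_dir_deriv] by simp

lemma continuous_unit_dir [continuous_intros]:
  fixes f :: "real \<Rightarrow> real"
  assumes "continuous_on S f"
  shows "continuous_on S (\<lambda>x. unit_dir (f x))"
  by (subst unit_dir_conv) (intro continuous_intros assms)

lemma periodic_int_shift:
  fixes f :: "real \<Rightarrow> 'a"
  assumes "\<And>x. f (x + c) = f x"
  shows "f (x + c * of_int k) = f x"
proof (induction k arbitrary: x rule: int_induct[where k = 0])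
  case (step1 i)
  then show ?case using assms[of "x + c * of_int i"] by (simp add: algebra_simps)
next
  case (step2 i)
  then show ?case using assms[of "x + c * of_int (i - 1)"] by (simp add: algebra_simps)
qed simp

lemma exists_period_shift:
  fixes x z c :: real
  assumes "0 < c"
  obtains k :: int where "x + c * of_int k \<in> {z..<z + c}"
proof -
  have "x + c * of_int (- \<lfloor>(x - z) / c\<rfloor>) = z + c * frac ((x - z) / c)"
    using assms by (simp add: frac_def field_simps)
  moreover have "c * frac ((x - z) / c) < c * 1"
    using assms frac_lt_1 by (intro mult_strict_left_mono) auto
  moreover have "0 \<le> c * frac ((x - z) / c)" using assms by simp
  ultimately show ?thesis using that[of "- \<lfloor>(x - z) / c\<rfloor>"] by simp
qed

lemma unit_dir_image: "unit_dir ` {0..<2*pi} = sphere 0 1"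
proof (intro equalityI subsetI)
  fix u :: "real^2" assume "u \<in> sphere 0 1"
  then obtain a where a: "u = unit_dir a" using norm_1_unit_dir by auto
  obtain k :: int where k: "a + 2 * pi * of_int k \<in> {0..<0 + 2 * pi}"
    using exists_period_shift[of "2 * pi" a 0] by auto
  have "unit_dir (a + 2 * pi * of_int k) = u"
    unfolding a by (rule periodic_int_shift) simp
  then show "u \<in> unit_dir ` {0..<2*pi}" using k by force
qed auto

text \<open>The uniform lower bound on the derivative forces linear growth, hence surjectivity onto
  the whole line; the inverse is therefore global. It will invert the normal angle as a function of
  the curve parameter.\<close>

lemma C1_inverse:
  fixes F F' :: "real \<Rightarrow> real"
  assumes F: "\<And>x. (F has_real_derivative F' x) (at x)" and c: "0 < c" "\<And>x. c \<le> F' x"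
  obtains G where "\<And>y. F (G y) = y" "\<And>x. G (F x) = x"
    "\<And>y. (G has_real_derivative inverse (F' (G y))) (at y)"
proof -
  have grow: "F x + c * (y - x) \<le> F y" if "x \<le> y" for x y
  proof (cases "x = y")
    case False
    then have "x < y" using that by simp
    from MVT2[OF this F] obtain z where "F y - F x = (y - x) * F' z" by blast
    then show ?thesis using c(2)[of z] that mult_left_mono[of c "F' z" "y - x"] by (simp add: mult.commute)
  qed simp
  have cont: "isCont F x" for x using F DERIV_isCont by blast
  have smono: "strict_mono F"
  proof (rule strict_monoI)
    fix x y :: real assume "x < y"
    then show "F x < F y" using grow[of x y] c(1) mult_pos_pos[of c "y - x"] by linarith
  qed
  have surj: "\<exists>x. F x = y" for y
  proof -
    define M where "M = \<bar>y - F 0\<bar> / c"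
    have M: "0 \<le> M" "c * M = \<bar>y - F 0\<bar>" using c by (auto simp: M_def)
    have "F (- M) \<le> y" "y \<le> F M" using grow[of "- M" 0] grow[of 0 M] M by auto
    then show ?thesis using IVT[of F "- M" y M] M cont by auto
  qed
  define G where "G = inv F"
  have FG: "F (G y) = y" for y
    unfolding G_def using surj by (metis f_inv_into_f rangeI)
  have GF: "G (F x) = x" for x
    unfolding G_def using smono strict_mono_imp_inj_on by (simp add: strict_mono_imp_inj_on)
  have contG: "isCont G y" for y
  proof -
    have "isCont G (F (G y))"
      by (rule isCont_inverse_function[of 1]) (use GF cont in auto)
    then show ?thesis by (simp add: FG)
  qed
  have "(G has_real_derivative inverse (F' (G y))) (at y)" for y
    by (rule DERIV_inverse_function[where f = F and a = "y - 1" and b = "y + 1"])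
      (use F FG contG c(1) c(2)[of "G y"] in auto)
  with FG GF show ?thesis using that by blast
qed

section \<open>Support functions and outer normals\<close>

lemma support_function_ge:
  assumes "bounded K" "y \<in> K"
  shows "x \<bullet> y \<le> support_function K x"
proof -
  obtain B where "\<And>y. y \<in> K \<Longrightarrow> norm y \<le> B" using assms(1) by (auto simp: bounded_iff)
  then have "x \<bullet> y \<le> norm x * B" if "y \<in> K" for y
    using that norm_cauchy_schwarz[of x y] by (meson mult_left_mono norm_ge_zero order_trans)
  then have "bdd_above ((\<lambda>y. x \<bullet> y) ` K)" by (auto intro!: bdd_aboveI)
  then show ?thesis unfolding support_function_def using assms(2) by (intro cSUP_upper)
qed

lemma support_function_le:
  assumes "K \<noteq> {}" "\<And>y. y \<in> K \<Longrightarrow> x \<bullet> y \<le> c"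
  shows "support_function K x \<le> c"
  unfolding support_function_def using assms by (intro cSUP_least)

lemma support_function_eq_outer_normal:
  assumes "bounded K" "outer_normal K p u" "p \<in> K"
  shows "support_function K u = p \<bullet> u"
  using assms support_function_ge[of K p u] support_function_le[of K u "p \<bullet> u"]
  by (force simp: outer_normal_def inner_commute intro!: antisym)

lemma exists_outer_normal:
  assumes "compact K" "convex K" "interior K \<noteq> {}" "p \<in> frontier K"
  shows "\<exists>u. outer_normal K p u"
proof -
  have "p \<in> closure K" "p \<notin> rel_interior K"
    using assms by (auto simp: frontier_def rel_interior_nonempty_interior)
  then obtain a where a: "a \<noteq> 0" "\<And>y. y \<in> closure K \<Longrightarrow> a \<bullet> p \<le> a \<bullet> y"
    using supporting_hyperplane_rel_boundary[of K p] assms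
    by (metis closure_subset closure_closed compact_imp_closed)
  \<comment> \<open>The supporting hyperplane bounds the body from below in direction
    \<open>a\<close>, so the outward direction is the opposite one.\<close>
  have "outer_normal K p (- a /\<^sub>R norm a)"
    unfolding outer_normal_def
    using a assms closure_subset[of K]
    by (auto simp: inner_commute divide_inverse intro!: mult_left_mono)
  then show ?thesis by blast
qed

text \<open>Meant for the height of the boundary curve in the direction of an outer normal. A
  positive second derivative would make \<open>f'\<close> positive just to the right of
  \<open>t\<close>, so \<open>f\<close> would exceed its maximum.\<close>

lemma second_derivative_local_max:
  fixes f f' :: "real \<Rightarrow> real"
  assumes f: "\<And>x. (f has_real_derivative f' x) (at x)" and f': "(f' has_real_derivative l) (at t)"
    and max: "\<And>x. f x \<le> f t"
  shows "f' t = 0" "l \<le> 0"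
proof -
  show 0: "f' t = 0" using DERIV_local_max[OF f, of 1 t] max by simp
  show "l \<le> 0"
  proof (rule ccontr)
    assume "\<not> l \<le> 0"
    then obtain d where d: "d > 0" "\<And>h. 0 < h \<Longrightarrow> h < d \<Longrightarrow> 0 < f' (t + h)"
      using DERIV_pos_inc_right[OF f'] 0 by (metis not_le)
    have "t < t + d / 2" using d by simp
    from MVT2[OF this f] obtain z where z: "t < z" "z < t + d / 2" "f (t + d / 2) - f t = d / 2 * f' z"
      by auto
    then have "0 < f' z" using d(2)[of "z - t"] by simp
    then have "0 < d / 2 * f' z" using d(1) by simp
    then show False using z(3) max[of "t + d / 2"] by linarith
  qed
qed

section \<open>Gauss map of a positively curved boundary\<close>

locale curved_boundary =
  fixes K :: "(real^2) set" and \<gamma> :: "real \<Rightarrow> real^2"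
  assumes compact: "compact K" and convex: "convex K"
    and zero_interior: "0 \<in> interior K"
    and param: "boundary_param K \<gamma>"
    and curvature_pos: "\<And>t. 0 < curve_curvature \<gamma> t"
begin

definition v where "v t = vector_derivative \<gamma> (at t)"
definition w where "w t = vector_derivative v (at t)"
text \<open>The determinant of velocity and acceleration: the signed curvature times the cube of the
  speed.\<close>

definition cross where "cross t = rot90 (v t) \<bullet> w t"

lemma \<gamma>_deriv: "(\<gamma> has_vector_derivative v t) (at t)"
  using param unfolding boundary_param_def v_def C1_differentiable_on_eq
  by (simp add: vector_derivative_works)

lemma v_deriv: "(v has_vector_derivative w t) (at t)"
  using param unfolding boundary_param_def v_def[abs_def, symmetric] w_def C1_differentiable_on_eq
  by (simp add: vector_derivative_works)

lemma continuous_w: "continuous_on S w"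
proof -
  have "continuous_on UNIV w"
    using param unfolding boundary_param_def v_def[abs_def, symmetric] w_def[abs_def] C1_differentiable_on_eq
    by simp
  then show ?thesis by (rule continuous_on_subset) simp
qed

lemma continuous_v: "continuous_on S v"
  by (meson continuous_at_imp_continuous_on has_vector_derivative_continuous v_deriv)

lemma v_nonzero: "v t \<noteq> 0"
  using param unfolding boundary_param_def v_def by blast

lemma curve_curvature_eq: "curve_curvature \<gamma> t = \<bar>cross t\<bar> / norm (v t) ^ 3"
  unfolding curve_curvature_def Let_def cross_def w_def v_def[abs_def]
  by (simp add: inner_2 abs_minus_commute algebra_simps)

lemma cross_nonzero: "cross t \<noteq> 0"
  using curvature_pos[of t] by (auto simp: curve_curvature_eq)

lemma frontier_eq: "frontier K = range \<gamma>"
  using param unfolding boundary_param_def by blast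

lemma frontier_subset: "frontier K \<subseteq> K"
  by (simp add: compact compact_imp_closed frontier_subset_closed)

lemma periodic: "\<gamma> (t + 1) = \<gamma> t" "v (t + 1) = v t" "w (t + 1) = w t"
proof -
  have *: "g' (t + 1) = g' t"
    if g: "\<And>t. (g has_vector_derivative g' t) (at t)" and per: "\<And>t. g (t + 1) = g t"
    for g g' :: "real \<Rightarrow> real^2" and t
  proof -
    have "((g \<circ> (\<lambda>s. s + 1)) has_vector_derivative 1 *\<^sub>R g' (t + 1)) (at t)"
      by (rule vector_diff_chain_at) (auto intro!: derivative_eq_intros g)
    then have "(g has_vector_derivative g' (t + 1)) (at t)" by (simp add: o_def per)
    then show ?thesis using g vector_derivative_unique_at by blast
  qed
  show \<gamma>: "\<gamma> (t + 1) = \<gamma> t" for t using param unfolding boundary_param_def by blast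
  show v: "v (t + 1) = v t" for t using *[OF \<gamma>_deriv \<gamma>] .
  show "w (t + 1) = w t" using *[OF v_deriv v] .
qed

text \<open>The orientation of the curve, 1 for counterclockwise. It has to be carried along because
  a boundary parametrization may run either way and \<open>curve_curvature\<close> is
  unsigned.\<close>

definition \<sigma> where "\<sigma> = sgn (cross 0)"

lemma continuous_cross: "continuous_on S cross"
  unfolding cross_def
  by (intro continuous_on_inner bounded_linear.continuous_on[OF bounded_linear_rot90]
      continuous_v continuous_w)

text \<open>A continuous function without zeros on the line keeps its sign, and positive curvature
  excludes zeros.\<close>

lemma sgn_cross: "sgn (cross t) = \<sigma>"
proof -
  have "connected (range cross)"
    by (intro connected_continuous_image continuous_cross) auto
  have no_sign_change: "\<not> (cross a < 0 \<and> 0 < cross b)" for a b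
  proof (intro notI)
    assume ab: "cross a < 0 \<and> 0 < cross b"
    have "0 \<in> range cross"
      by (rule connectedD_interval[of "range cross" "cross a" "cross b" 0])
        (use ab \<open>connected (range cross)\<close> in auto)
    then obtain s where "0 = cross s" by (rule rangeE)
    then show False using cross_nonzero[of s] by simp
  qed
  show ?thesis
  proof (cases "0 < cross t")
    case True
    then have "0 < cross 0" using no_sign_change[of 0 t] cross_nonzero[of 0] by linarith
    with True show ?thesis by (simp add: \<sigma>_def)
  next
    case False
    then have "cross t < 0" using cross_nonzero[of t] by linarith
    then have "cross 0 < 0" using no_sign_change[of t 0] cross_nonzero[of 0] by linarith
    with \<open>cross t < 0\<close> show ?thesis by (simp add: \<sigma>_def)
  qed
qed

lemma \<sigma>_sign: "\<sigma> = 1 \<or> \<sigma> = - 1" "\<sigma> * \<sigma> = 1" "\<sigma> * cross t = \<bar>cross t\<bar>"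
proof -
  show "\<sigma> = 1 \<or> \<sigma> = - 1" unfolding \<sigma>_def using cross_nonzero by (auto simp: sgn_if)
  then show "\<sigma> * \<sigma> = 1" by auto
  show "\<sigma> * cross t = \<bar>cross t\<bar>" unfolding sgn_cross[symmetric, of t] by (simp add: sgn_if)
qed

definition n where "n t = (- \<sigma> / norm (v t)) *\<^sub>R rot90 (v t)"

text \<open>The height of the curve in direction \<open>u\<close> is maximal at \<open>t\<close>.
  The first-order condition makes \<open>u\<close> orthogonal to the velocity; the second-order
  condition decides between the two unit normals, through the sign of \<open>cross\<close>.\<close>

lemma outer_normal_imp:
  assumes "outer_normal K (\<gamma> t) u"
  shows "u = n t"
proof -
  have max: "\<gamma> s \<bullet> u \<le> \<gamma> t \<bullet> u" for s
    using assms frontier_subset frontier_eq unfolding outer_normal_def by blast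
  have u: "norm u = 1" using assms by (simp add: outer_normal_def)
  have d1: "((\<lambda>s. \<gamma> s \<bullet> u) has_real_derivative v s \<bullet> u) (at s)" for s
    unfolding has_real_derivative_iff_has_vector_derivative
    by (rule bounded_linear.has_vector_derivative[OF bounded_linear_inner_left \<gamma>_deriv])
  have d2: "((\<lambda>s. v s \<bullet> u) has_real_derivative w s \<bullet> u) (at s)" for s
    unfolding has_real_derivative_iff_has_vector_derivative
    by (rule bounded_linear.has_vector_derivative[OF bounded_linear_inner_left v_deriv])
  have vu: "v t \<bullet> u = 0" and wu: "w t \<bullet> u \<le> 0"
    using second_derivative_local_max[OF d1 d2 max] by auto
  define c where "c = v t \<bullet> rot90 u"
  have v_eq: "v t = c *\<^sub>R rot90 u"
    using plane_decomposition[OF u, of "v t"] vu by (simp add: c_def)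
  then have "rot90 (v t) = - c *\<^sub>R u" by simp
  then have "cross t = - c * (w t \<bullet> u)" by (simp add: cross_def inner_commute)
  moreover from this have "w t \<bullet> u < 0" "c \<noteq> 0" using wu cross_nonzero[of t] by auto
  ultimately have "\<sigma> = sgn c" using sgn_cross[of t] by (simp add: sgn_mult)
  moreover have "norm (v t) = \<bar>c\<bar>" using v_eq u by simp
  ultimately show ?thesis
    using \<open>rot90 (v t) = - c *\<^sub>R u\<close> \<open>c \<noteq> 0\<close> by (simp add: n_def sgn_if abs_if)
qed

lemma outer_normal_iff: "outer_normal K (\<gamma> t) u \<longleftrightarrow> u = n t"
  using exists_outer_normal[of K "\<gamma> t"] outer_normal_imp compact convex zero_interior frontier_eq
  by blast

text \<open>The angular velocity of the normal: signed curvature times speed.\<close>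

definition \<omega> where "\<omega> t = cross t / (norm (v t))\<^sup>2"

lemma norm_n: "norm (n t) = 1"
  using \<sigma>_sign(1) v_nonzero[of t] by (auto simp: n_def)

lemma continuous_\<omega>: "continuous_on S \<omega>"
  unfolding \<omega>_def using v_nonzero by (intro continuous_intros continuous_cross continuous_v) auto

lemma rot90_n: "rot90 (n t) = (\<sigma> / norm (v t)) *\<^sub>R v t"
  by (simp add: n_def)

lemma n_deriv: "(n has_vector_derivative \<omega> t *\<^sub>R rot90 (n t)) (at t)"
proof -
  define N where "N = norm (v t)"
  have N: "N \<noteq> 0" "v t \<bullet> v t = N * N" using v_nonzero[of t] by (auto simp: N_def dot_square_norm power2_eq_square)
  have pos: "0 < v t \<bullet> v t" using v_nonzero by simp
  have "((\<lambda>s. v s \<bullet> v s) has_vector_derivative v t \<bullet> w t + w t \<bullet> v t) (at t)"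
    by (rule bounded_bilinear.has_vector_derivative[OF bounded_bilinear_inner v_deriv v_deriv])
  then have "((\<lambda>s. v s \<bullet> v s) has_real_derivative 2 * (v t \<bullet> w t)) (at t)"
    by (simp add: has_real_derivative_iff_has_vector_derivative inner_commute)
  from DERIV_chain2[OF DERIV_real_sqrt[OF pos] this] have
    "((\<lambda>s. sqrt (v s \<bullet> v s)) has_real_derivative inverse (sqrt (v t \<bullet> v t)) / 2 * (2 * (v t \<bullet> w t))) (at t)" .
  then have "((\<lambda>s. norm (v s)) has_real_derivative (v t \<bullet> w t) / N) (at t)"
    unfolding N_def norm_eq_sqrt_inner by (rule DERIV_cong) (simp add: field_simps)
  then have "((\<lambda>s. - \<sigma> / norm (v s)) has_real_derivative
      (0 * norm (v t) - - \<sigma> * ((v t \<bullet> w t) / N)) / (norm (v t) * norm (v t))) (at t)"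
    by (rule DERIV_divide[OF DERIV_const]) (simp add: v_nonzero)
  then have d1: "((\<lambda>s. - \<sigma> / norm (v s)) has_real_derivative \<sigma> * (v t \<bullet> w t) / N ^ 3) (at t)"
    by (rule DERIV_cong) (simp add: N_def power3_eq_cube)
  have d2: "((\<lambda>s. rot90 (v s)) has_vector_derivative rot90 (w t)) (at t)"
    by (rule bounded_linear.has_vector_derivative[OF bounded_linear_rot90 v_deriv])
  have d: "(n has_vector_derivative (- \<sigma> / N) *\<^sub>R rot90 (w t) + (\<sigma> * (v t \<bullet> w t) / N ^ 3) *\<^sub>R rot90 (v t)) (at t)"
    unfolding n_def[abs_def] N_def
    by (rule has_vector_derivative_scaleR[OF d1[unfolded N_def] d2])
  \<comment> \<open>This is the decomposition of \<open>w t\<close> along \<open>v t\<close> and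
    \<open>rot90 (v t)\<close>, turned by a right angle. It removes the tangential acceleration from
    the derivative of the normal.\<close>
  have "(v t \<bullet> w t) *\<^sub>R rot90 (v t) - (N * N) *\<^sub>R rot90 (w t) = cross t *\<^sub>R v t"
    unfolding N(2)[symmetric] cross_def
    by (simp add: vec_eq_iff forall_2 inner_2 algebra_simps)
  note expand = this
  have e: "\<sigma> / N ^ 3 * (N * N) = \<sigma> / N" using N by (simp add: power3_eq_cube)
  have "(- \<sigma> / N) *\<^sub>R rot90 (w t) + (\<sigma> * (v t \<bullet> w t) / N ^ 3) *\<^sub>R rot90 (v t)
      = (\<sigma> / N ^ 3) *\<^sub>R ((v t \<bullet> w t) *\<^sub>R rot90 (v t) - (N * N) *\<^sub>R rot90 (w t))"
    unfolding scaleR_diff_right scaleR_scaleR e by simp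
  also have "\<dots> = (\<sigma> / N ^ 3 * cross t) *\<^sub>R v t"
    unfolding expand by simp
  also have "\<dots> = \<omega> t *\<^sub>R rot90 (n t)"
    unfolding \<omega>_def rot90_n N_def[symmetric] scaleR_scaleR
    by (rule arg_cong[of _ _ "\<lambda>c. c *\<^sub>R v t"]) (simp add: power2_eq_square power3_eq_cube)
  finally show ?thesis using d by simp
qed

text \<open>Lifts the normal to a real angle by integrating its angular velocity. Both
  \<open>n\<close> and \<open>unit_dir\<close> of the integral solve D' = \<omega>
  \<open>rot90\<close> D; their difference does too, so its length is constant, and it starts at
  0.\<close>

lemma exists_angle:
  obtains \<alpha> where "\<And>t. (\<alpha> has_real_derivative \<omega> t) (at t)" "\<And>t. n t = unit_dir (\<alpha> t)"
proof -
  obtain a0 where a0: "n 0 = unit_dir a0" using norm_1_unit_dir norm_n by blast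
  obtain \<beta> where \<beta>: "\<And>t. (\<beta> has_real_derivative \<omega> t) (at t)"
  proof -
    have "\<exists>F. \<forall>t. - \<infinity> < ereal t \<longrightarrow> ereal t < \<infinity> \<longrightarrow> (F has_vector_derivative \<omega> t) (at t)"
      using continuous_\<omega>[of UNIV] by (intro einterval_antiderivative) (auto simp: continuous_on_eq_continuous_at)
    then show ?thesis using that by (auto simp: has_real_derivative_iff_has_vector_derivative)
  qed
  define \<alpha> where "\<alpha> t = \<beta> t - \<beta> 0 + a0" for t
  have \<alpha>: "(\<alpha> has_real_derivative \<omega> t) (at t)" for t
    unfolding \<alpha>_def[abs_def] by (auto intro!: derivative_eq_intros \<beta>)
  define D where "D t = n t - unit_dir (\<alpha> t)" for t
  have D': "(D has_vector_derivative \<omega> t *\<^sub>R rot90 (D t)) (at t)" for t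
    unfolding D_def[abs_def] using has_vector_derivative_diff[OF n_deriv[of t] unit_dir_has_vector_derivative[OF \<alpha>[of t]]]
    by (simp add: linear_diff[OF linear_rot90] scaleR_diff_right)
  have "((\<lambda>s. D s \<bullet> D s) has_vector_derivative D t \<bullet> (\<omega> t *\<^sub>R rot90 (D t)) + (\<omega> t *\<^sub>R rot90 (D t)) \<bullet> D t) (at t)" for t
    by (rule bounded_bilinear.has_vector_derivative[OF bounded_bilinear_inner D' D'])
  then have "((\<lambda>s. D s \<bullet> D s) has_real_derivative 0) (at t)" for t
    by (simp add: has_real_derivative_iff_has_vector_derivative)
  then have "D t \<bullet> D t = D 0 \<bullet> D 0" for t
    using DERIV_isconst_all[of "\<lambda>s. D s \<bullet> D s" t 0] by blast
  moreover have "D 0 = 0" by (simp add: D_def \<alpha>_def a0)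
  ultimately have "n t = unit_dir (\<alpha> t)" for t by (simp add: D_def)
  with \<alpha> show ?thesis using that by blast
qed

text \<open>Compactness of one period gives the bound that the global inverse of the angle
  requires.\<close>

lemma \<omega>_bounded_below: "\<exists>c>0. \<forall>t. c \<le> \<bar>\<omega> t\<bar>"
proof -
  have per: "\<omega> (t + 1) = \<omega> t" for t by (simp add: \<omega>_def cross_def periodic)
  have per_int: "\<omega> (t + of_int k) = \<omega> t" for t k
    using periodic_int_shift[of \<omega> 1 t k] per by simp
  have cont: "continuous_on {0..1} (\<lambda>t. \<bar>\<omega> t\<bar>)" by (intro continuous_intros continuous_\<omega>)
  obtain t0 where t0: "\<forall>t\<in>{0..1}. \<bar>\<omega> t0\<bar> \<le> \<bar>\<omega> t\<bar>"
    using continuous_attains_inf[OF compact_Icc _ cont] by auto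
  have "\<bar>\<omega> t0\<bar> \<le> \<bar>\<omega> t\<bar>" for t
  proof -
    have "\<omega> (frac t) = \<omega> t" using per_int[of "frac t" "\<lfloor>t\<rfloor>"] by (simp add: frac_def)
    moreover have "frac t \<in> {0..1}" using frac_lt_1[of t] by simp
    ultimately show ?thesis using t0 by metis
  qed
  moreover have "0 < \<bar>\<omega> t0\<bar>" using cross_nonzero v_nonzero by (simp add: \<omega>_def)
  ultimately show ?thesis by blast
qed

text \<open>The lifted angle moves in the direction of \<open>\<sigma>\<close>, so it is
  \<open>\<sigma>\<close> times the angle that increases and can be inverted. The last clause says
  that a normal direction determines the parameter up to full turns of the angle.\<close>

lemma angle_parametrization:
  obtains \<tau> where "\<And>a. n (\<tau> a) = unit_dir a" "range \<tau> = UNIV"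
    "\<And>a. (\<tau> has_real_derivative 1 / \<omega> (\<tau> a)) (at a)"
    "\<And>t a. n t = unit_dir a \<Longrightarrow> \<exists>k::int. t = \<tau> (a + 2 * pi * k)"
proof -
  obtain \<alpha> where \<alpha>: "\<And>t. (\<alpha> has_real_derivative \<omega> t) (at t)" "\<And>t. n t = unit_dir (\<alpha> t)"
    using exists_angle by blast
  obtain c where c: "0 < c" "\<And>t. c \<le> \<bar>\<omega> t\<bar>" using \<omega>_bounded_below by blast
  have \<sigma>\<omega>: "\<sigma> * \<omega> t = \<bar>\<omega> t\<bar>" for t using \<sigma>_sign(3)[of t] by (simp add: \<omega>_def abs_divide)
  obtain G where G: "\<And>y. \<sigma> * \<alpha> (G y) = y" "\<And>x. G (\<sigma> * \<alpha> x) = x"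
    "\<And>y. (G has_real_derivative inverse (\<sigma> * \<omega> (G y))) (at y)"
  proof (rule C1_inverse[of "\<lambda>t. \<sigma> * \<alpha> t" "\<lambda>t. \<sigma> * \<omega> t" c])
    show "((\<lambda>t. \<sigma> * \<alpha> t) has_real_derivative \<sigma> * \<omega> x) (at x)" for x
      by (intro DERIV_cmult \<alpha>)
  qed (use c \<sigma>\<omega> in auto)
  define \<tau> where "\<tau> a = G (\<sigma> * a)" for a
  have \<tau>\<alpha>: "\<tau> (\<alpha> t) = t" for t by (simp add: \<tau>_def G)
  have \<alpha>\<tau>: "\<alpha> (\<tau> a) = a" for a
  proof -
    have "\<sigma> * (\<sigma> * \<alpha> (\<tau> a)) = \<sigma> * (\<sigma> * a)" unfolding \<tau>_def G(1) ..
    then show ?thesis by (simp only: mult.assoc[symmetric] \<sigma>_sign(2) mult_1_left)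
  qed
  show ?thesis
  proof (rule that[of \<tau>])
    show "n (\<tau> a) = unit_dir a" for a by (simp add: \<alpha> \<alpha>\<tau>)
    show "range \<tau> = UNIV" using \<tau>\<alpha> by (metis surjI)
    show "(\<tau> has_real_derivative 1 / \<omega> (\<tau> a)) (at a)" for a
    proof -
      have "(\<tau> has_real_derivative inverse (\<sigma> * \<omega> (G (\<sigma> * a))) * \<sigma>) (at a)"
        unfolding \<tau>_def[abs_def] by (rule DERIV_chain2[OF G(3)]) (auto intro!: derivative_eq_intros)
      moreover have "inverse (\<sigma> * \<omega> (\<tau> a)) * \<sigma> = 1 / \<omega> (\<tau> a)"
        using \<sigma>_sign(1) by (auto simp: divide_inverse)
      ultimately show ?thesis by (simp add: \<tau>_def)
    qed
    show "\<exists>k::int. t = \<tau> (a + 2 * pi * k)" if "n t = unit_dir a" for t a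
      using that \<alpha>(2)[of t] unit_dir_eq_iff[of "\<alpha> t" a] \<tau>\<alpha>[of t] by auto
  qed
qed

end

section \<open>Regularity of the support function\<close>

definition curvature_radius :: "(real^2) set \<Rightarrow> real \<Rightarrow> real" where
  "curvature_radius K a = support_angle K a + deriv (deriv (support_angle K)) a"

text \<open>The gradient of the support function at \<open>unit_dir a\<close>, known to be the
  boundary point with this outer normal.\<close>

definition boundary_point :: "(real^2) set \<Rightarrow> real \<Rightarrow> real^2" where
  "boundary_point K a = support_angle K a *\<^sub>R unit_dir a + deriv (support_angle K) a *\<^sub>R rot90 (unit_dir a)"

context curved_boundary
begin

text \<open>Write the boundary point \<open>x\<close> as a function of the normal angle. Its
  derivative is \<open>\<rho>\<close> times the tangent direction, orthogonal to the normal, so h =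
  x \<bullet> u has derivative x \<bullet> \<open>rot90\<close> u, in which the derivative of
  \<open>x\<close> no longer occurs. A second differentiation gives h'' = \<rho> - h.\<close>

theorem support_angle_smooth:
  shows "smooth_support (support_angle K) (deriv (support_angle K)) (deriv (deriv (support_angle K)))"
    and "frontier K = range (boundary_point K)"
    and "boundary_point K a = boundary_point K b \<Longrightarrow> unit_dir a = unit_dir b"
    and "outer_normal K (\<gamma> t) (unit_dir a) \<Longrightarrow> curve_curvature \<gamma> t = 1 / curvature_radius K a"
    and "\<exists>t. outer_normal K (\<gamma> t) (unit_dir a)"
proof -
  obtain \<tau> where \<tau>: "\<And>a. n (\<tau> a) = unit_dir a" "range \<tau> = UNIV"
    "\<And>a. (\<tau> has_real_derivative 1 / \<omega> (\<tau> a)) (at a)"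
    "\<And>t a. n t = unit_dir a \<Longrightarrow> \<exists>k::int. t = \<tau> (a + 2 * pi * k)"
    using angle_parametrization by blast
  let ?h = "support_angle K"
  define x where "x a = \<gamma> (\<tau> a)" for a
  define \<rho> where "\<rho> a = 1 / curve_curvature \<gamma> (\<tau> a)" for a
  have v_eq: "v (\<tau> a) = (\<sigma> * norm (v (\<tau> a))) *\<^sub>R rot90 (unit_dir a)" for a
  proof -
    have "(\<sigma> * norm (v (\<tau> a))) *\<^sub>R rot90 (n (\<tau> a)) = (\<sigma> * \<sigma>) *\<^sub>R v (\<tau> a)"
      using v_nonzero[of "\<tau> a"] by (simp add: rot90_n)
    then show ?thesis by (simp only: \<sigma>_sign(2) \<tau>(1) scaleR_one)
  qed
  have x': "(x has_vector_derivative \<rho> a *\<^sub>R rot90 (unit_dir a)) (at a)" for a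
  proof -
    have "(\<tau> has_vector_derivative 1 / \<omega> (\<tau> a)) (at a)"
      using \<tau>(3) by (simp add: has_real_derivative_iff_has_vector_derivative)
    from vector_diff_chain_at[OF this \<gamma>_deriv]
    have "(x has_vector_derivative (1 / \<omega> (\<tau> a)) *\<^sub>R v (\<tau> a)) (at a)"
      by (simp add: x_def[abs_def] o_def)
    moreover have eq: "1 / \<omega> (\<tau> a) * (\<sigma> * norm (v (\<tau> a))) = \<rho> a"
      using \<sigma>_sign(1) \<sigma>_sign(3)[of "\<tau> a"] cross_nonzero[of "\<tau> a"] v_nonzero[of "\<tau> a"]
      by (auto simp: \<rho>_def curve_curvature_eq \<omega>_def field_simps power2_eq_square power3_eq_cube)
    moreover have "(1 / \<omega> (\<tau> a)) *\<^sub>R v (\<tau> a) = \<rho> a *\<^sub>R rot90 (unit_dir a)"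
      by (subst v_eq) (simp only: scaleR_scaleR eq)
    ultimately show ?thesis by simp
  qed
  have normal: "outer_normal K (x a) (unit_dir a)" for a
    by (simp add: x_def outer_normal_iff \<tau>)
  have h: "?h a = x a \<bullet> unit_dir a" for a
    unfolding support_angle_def
    using compact normal[of a] frontier_subset frontier_eq
    by (intro support_function_eq_outer_normal compact_imp_bounded) (auto simp: x_def)
  define h1 where "h1 a = x a \<bullet> rot90 (unit_dir a)" for a
  have h': "(?h has_real_derivative h1 a) (at a)" for a
    using bounded_bilinear.has_vector_derivative[OF bounded_bilinear_inner x' unit_dir_deriv, of a]
    by (simp add: h[abs_def] h1_def has_real_derivative_iff_has_vector_derivative)
  have h'': "(h1 has_real_derivative \<rho> a - ?h a) (at a)" for a
    using bounded_bilinear.has_vector_derivative[OF bounded_bilinear_inner x' rot90_unit_dir_deriv, of a]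
    by (simp add: h h1_def[abs_def] has_real_derivative_iff_has_vector_derivative)
  have d1: "deriv ?h = h1" using h' DERIV_imp_deriv by blast
  have d2: "deriv h1 = (\<lambda>a. \<rho> a - ?h a)" using h'' DERIV_imp_deriv by blast
  have radius: "curvature_radius K a = \<rho> a" for a by (simp add: curvature_radius_def d1 d2)
  have point: "boundary_point K = x"
    unfolding boundary_point_def[abs_def] d1 h h1_def
    by (intro ext plane_decomposition[symmetric] norm_unit_dir)
  have per: "?h (a + 2 * pi) = ?h a" for a by (simp add: support_angle_def)
  have \<rho>_pos: "0 < \<rho> a" for a using curvature_pos by (simp add: \<rho>_def)
  have cont_\<tau>: "continuous_on UNIV \<tau>" by (rule DERIV_continuous_on, rule \<tau>(3))
  have cont_h: "continuous_on UNIV ?h" by (rule DERIV_continuous_on, rule h')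
  have cont_\<rho>: "continuous_on UNIV \<rho>"
  proof -
    have ne: "curve_curvature \<gamma> (\<tau> a) \<noteq> 0" for a using curvature_pos[of "\<tau> a"] by simp
    have "continuous_on UNIV (curve_curvature \<gamma>)"
      unfolding curve_curvature_eq[abs_def] using v_nonzero
      by (intro continuous_intros continuous_cross continuous_v) auto
    then have "continuous_on UNIV (\<lambda>a. curve_curvature \<gamma> (\<tau> a))"
      by (rule continuous_on_compose2[OF _ cont_\<tau>]) simp
    then show ?thesis unfolding \<rho>_def[abs_def]
      by (rule continuous_on_divide[OF continuous_on_const]) (simp only: ne, simp)
  qed
  have h_pos: "0 < ?h a" for a
  proof -
    obtain e where e: "0 < e" "cball 0 e \<subseteq> K" using zero_interior by (meson mem_interior_cball)
    then have "unit_dir a \<bullet> (e *\<^sub>R unit_dir a) \<le> support_function K (unit_dir a)"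
      using compact by (intro support_function_ge compact_imp_bounded) (auto simp: subset_iff)
    then show ?thesis using e by (simp add: support_angle_def)
  qed
  show smooth: "smooth_support ?h (deriv ?h) (deriv (deriv ?h))"
    unfolding d1 d2
  proof unfold_locales
    show "continuous_on UNIV (\<lambda>a. \<rho> a - ?h a)" by (rule continuous_on_diff[OF cont_\<rho> cont_h])
    show "0 < ?h a + (\<rho> a - ?h a)" for a using \<rho>_pos[of a] by simp
  qed (rule h' h'' per h_pos)+
  show "frontier K = range (boundary_point K)"
  proof -
    have "range x = \<gamma> ` range \<tau>" unfolding x_def[abs_def] by (simp only: image_image)
    then show ?thesis by (simp only: point frontier_eq \<tau>(2))
  qed
  show "unit_dir a = unit_dir b" if "boundary_point K a = boundary_point K b"
  proof -
    have "x a = x b" using that by (simp add: point)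
    then have "outer_normal K (\<gamma> (\<tau> a)) (unit_dir b)" using normal[of b] by (simp add: x_def)
    then show ?thesis by (simp add: outer_normal_iff \<tau>(1))
  qed
  show "\<exists>t. outer_normal K (\<gamma> t) (unit_dir a)" using normal unfolding x_def by blast
  show "curve_curvature \<gamma> t = 1 / curvature_radius K a" if "outer_normal K (\<gamma> t) (unit_dir a)"
  proof -
    interpret smooth_support ?h "deriv ?h" "deriv (deriv ?h)" by (rule smooth)
    have "n t = unit_dir a" using that by (simp add: outer_normal_iff)
    then obtain k :: int where k: "t = \<tau> (a + 2 * pi * k)" using \<tau>(4) by blast
    have "curvature_radius K (a + 2 * pi * k) = curvature_radius K a"
      by (rule periodic_int_shift) (simp add: curvature_radius_def periodic_h periodic_h2)
    then show ?thesis using radius k by (simp add: \<rho>_def)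
  qed
qed

end

subsection \<open>Area and cone-volume measure\<close>

lemma has_integral_half_open:
  fixes f :: "real \<Rightarrow> real"
  shows "(f has_integral y) {a<..b} \<longleftrightarrow> (f has_integral y) {a..b}"
    and "(f has_integral y) {a..<b} \<longleftrightarrow> (f has_integral y) {a..b}"
  by (rule has_integral_spike_set_eq;
      force intro: negligible_subset[OF negligible_sing[of a]] negligible_subset[OF negligible_sing[of b]])+

locale smooth_body =
  fixes K :: "(real^2) set"
  assumes compact: "compact K" and convex: "convex K" and zero_interior: "0 \<in> interior K"
    and smooth: "smooth_boundary K" and positive: "positive_curvature K"
begin

abbreviation h where "h \<equiv> support_angle K"
abbreviation \<rho> where "\<rho> \<equiv> curvature_radius K"

lemma curved_boundary: "boundary_param K \<gamma> \<Longrightarrow> curved_boundary K \<gamma>"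
  using compact convex zero_interior positive by unfold_locales (auto simp: positive_curvature_def)

lemma exists_param: "\<exists>\<gamma>. boundary_param K \<gamma>"
  using smooth by (simp add: smooth_boundary_def)

end

sublocale smooth_body \<subseteq> smooth_support h "deriv h" "deriv (deriv h)"
  using exists_param curved_boundary curved_boundary.support_angle_smooth(1) by blast

context smooth_body
begin

lemma frontier_eq: "frontier K = range (boundary_point K)"
  using exists_param curved_boundary curved_boundary.support_angle_smooth(2) by blast

lemma boundary_point_eqD: "boundary_point K a = boundary_point K b \<Longrightarrow> unit_dir a = unit_dir b"
  using exists_param curved_boundary curved_boundary.support_angle_smooth(3) by blast

lemma \<rho>_pos: "0 < \<rho> a"
  unfolding curvature_radius_def by (rule radius_pos)

lemma continuous_\<rho>: "continuous_on S \<rho>"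
  unfolding curvature_radius_def[abs_def] by (intro continuous_intros continuous)

text \<open>Every parametrization yields the same number, since the right-hand side depends on the
  body alone; this makes the description in \<open>curvature\<close> well defined.\<close>

lemma curvature_unit_dir: "curvature K (unit_dir a) = 1 / \<rho> a"
  unfolding curvature_def
proof (rule the_equality)
  obtain \<gamma> where \<gamma>: "boundary_param K \<gamma>" using exists_param by blast
  then obtain t where t: "outer_normal K (\<gamma> t) (unit_dir a)"
    using curved_boundary.support_angle_smooth(5)[OF curved_boundary] by blast
  then have "1 / \<rho> a = curve_curvature \<gamma> t"
    using curved_boundary.support_angle_smooth(4)[OF curved_boundary[OF \<gamma>]] by simp
  with \<gamma> t show "\<exists>\<gamma> t. boundary_param K \<gamma> \<and> outer_normal K (\<gamma> t) (unit_dir a) \<and> 1 / \<rho> a = curve_curvature \<gamma> t"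
    by blast
next
  fix k assume "\<exists>\<gamma> t. boundary_param K \<gamma> \<and> outer_normal K (\<gamma> t) (unit_dir a) \<and> k = curve_curvature \<gamma> t"
  then show "k = 1 / \<rho> a"
    using curved_boundary.support_angle_smooth(4)[OF curved_boundary] by blast
qed

lemma support_ge: "y \<in> K \<Longrightarrow> y \<bullet> unit_dir a \<le> h a"
  unfolding support_angle_def using support_function_ge[of K y "unit_dir a"] compact_imp_bounded[OF compact]
  by (simp add: inner_commute)

lemma boundary_point_in: "boundary_point K a \<in> K"
  using frontier_eq frontier_subset_closed[of K] compact compact_imp_closed by blast

lemma boundary_point_inner: "boundary_point K a \<bullet> unit_dir a = h a"
  by (simp add: boundary_point_def inner_left_distrib)

lemma boundary_point_deriv: "(boundary_point K has_vector_derivative \<rho> a *\<^sub>R rot90 (unit_dir a)) (at a)"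
proof -
  have "(boundary_point K has_vector_derivative
      (h a *\<^sub>R rot90 (unit_dir a) + deriv h a *\<^sub>R unit_dir a) +
      (deriv h a *\<^sub>R (- unit_dir a) + deriv (deriv h) a *\<^sub>R rot90 (unit_dir a))) (at a)"
    unfolding boundary_point_def[abs_def]
    by (intro has_vector_derivative_add has_vector_derivative_scaleR DERIV_h DERIV_h1 unit_dir_deriv rot90_unit_dir_deriv)
  then show ?thesis by (simp add: curvature_radius_def scaleR_left_distrib)
qed

section \<open>Area in polar coordinates\<close>

text \<open>Coordinates of the cone over the boundary. The second coordinate is the angle of the
  normal, not of the position, so that the Jacobian is expressed by \<open>h\<close> and
  \<open>\<rho>\<close>.\<close>

definition polar :: "real^2 \<Rightarrow> real^2" where
  "polar z = z $ 1 *\<^sub>R boundary_point K (z $ 2)"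

text \<open>Radius 0 and the angle \<open>2*pi\<close> are left out to make \<open>polar\<close>
  injective; the image then misses only the origin.\<close>

definition polar_domain :: "(real^2) set" where
  "polar_domain = {z. z $ 1 \<in> {0<..1} \<and> z $ 2 \<in> {0..<2*pi}}"

text \<open>If two multiples of boundary points agree, pairing with the normal of the first point
  bounds its factor by the other one, since all of the body lies behind the supporting line. By
  symmetry the factors coincide.\<close>

lemma inj_on_polar: "inj_on polar polar_domain"
proof (rule inj_onI)
  have le: "s \<le> r" if eq: "s *\<^sub>R boundary_point K a = r *\<^sub>R boundary_point K b" and "0 < r" for s r a b
  proof -
    have "s * h a = (s *\<^sub>R boundary_point K a) \<bullet> unit_dir a" by (simp add: boundary_point_inner)
    also have "\<dots> = r * (boundary_point K b \<bullet> unit_dir a)" by (simp add: eq)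
    also have "\<dots> \<le> r * h a"
      by (rule mult_left_mono[OF support_ge[OF boundary_point_in]]) (use \<open>0 < r\<close> in simp)
    finally show ?thesis using h_pos[of a] by simp
  qed
  fix z z' assume z: "z \<in> polar_domain" "z' \<in> polar_domain" and "polar z = polar z'"
  then have eq: "z $ 1 *\<^sub>R boundary_point K (z $ 2) = z' $ 1 *\<^sub>R boundary_point K (z' $ 2)"
    by (simp only: polar_def)
  have pos: "0 < z $ 1" "0 < z' $ 1" using z by (simp_all add: polar_domain_def)
  have 1: "z $ 1 = z' $ 1"
    using le[OF eq pos(2)] le[OF eq[symmetric] pos(1)] by (rule antisym)
  have "boundary_point K (z $ 2) = boundary_point K (z' $ 2)"
    using eq pos unfolding 1 by simp
  then have "unit_dir (z $ 2) = unit_dir (z' $ 2)" by (rule boundary_point_eqD)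
  then have "z $ 2 = z' $ 2"
    by (rule inj_onD[OF unit_dir_inj]) (use z in \<open>simp_all add: polar_domain_def\<close>)
  with 1 show "z = z'" by (simp add: vec_eq_iff forall_2)
qed

lemma polar_image: "polar ` polar_domain = K - {0}"
proof (intro equalityI subsetI)
  fix y assume "y \<in> polar ` polar_domain"
  then obtain z where z: "z \<in> polar_domain" "y = polar z" by blast
  have "0 < z $ 1 * h (z $ 2)" using z h_pos by (auto simp: polar_domain_def)
  then have "y \<bullet> unit_dir (z $ 2) \<noteq> 0"
    unfolding z(2) polar_def inner_scaleR_left boundary_point_inner by linarith
  moreover have "y \<in> K"
    using z convexD_alt[OF convex, of 0 "boundary_point K (z $ 2)" "z $ 1"] boundary_point_in
      zero_interior interior_subset
    by (auto simp: polar_def polar_domain_def)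
  ultimately show "y \<in> K - {0}" by auto
next
  fix y assume y: "y \<in> K - {0}"
  obtain d where d: "0 < d" "0 + d *\<^sub>R y \<in> frontier K"
    using ray_to_frontier[OF compact_imp_bounded[OF compact] zero_interior, of y] y by blast
  then obtain a where a: "d *\<^sub>R y = boundary_point K a" using frontier_eq by auto
  obtain k :: int where "a + 2 * pi * of_int k \<in> {0..<0 + 2 * pi}"
    using exists_period_shift[of "2 * pi" a 0] by auto
  moreover define b where "b = a + 2 * pi * of_int k"
  ultimately have b: "b \<in> {0..<2*pi}" by simp
  have "boundary_point K b = boundary_point K a"
    unfolding b_def by (rule periodic_int_shift) (simp add: boundary_point_def periodic_h periodic_h1)
  then have dy: "d *\<^sub>R y = boundary_point K b" using a by simp
  \<comment> \<open>With \<open>d < 1\<close> the point \<open>y\<close> would lie beyond the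
    supporting line at \<open>d *\<^sub>R y\<close>.\<close>
  have "h b = d * (y \<bullet> unit_dir b)" using boundary_point_inner[of b] by (simp add: dy[symmetric])
  also have "\<dots> \<le> d * h b" using d y support_ge by (intro mult_left_mono) auto
  finally have "1 \<le> d" using h_pos[of b] by simp
  then have "polar (vector [1 / d, b]) = y" "vector [1 / d, b] \<in> polar_domain"
    using d b by (auto simp: polar_def polar_domain_def dy[symmetric])
  then show "y \<in> polar ` polar_domain" by (metis imageI)
qed

lemma polar_deriv:
  "(polar has_derivative (\<lambda>d. d $ 1 *\<^sub>R boundary_point K (z $ 2)
     + (z $ 1 * d $ 2 * \<rho> (z $ 2)) *\<^sub>R rot90 (unit_dir (z $ 2)))) (at z within S)"
proof -
  have p: "((\<lambda>z. boundary_point K (z $ 2)) has_derivative (\<lambda>d. d $ 2 *\<^sub>R \<rho> (z $ 2) *\<^sub>R rot90 (unit_dir (z $ 2)))) (at z within S)"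
    by (rule has_derivative_compose[OF bounded_linear_imp_has_derivative[OF bounded_linear_vec_nth]
        boundary_point_deriv[unfolded has_vector_derivative_def]])
  have "((\<lambda>z. z $ 1) has_derivative (\<lambda>d. d $ 1)) (at z within S)"
    by (rule bounded_linear_imp_has_derivative[OF bounded_linear_vec_nth])
  from has_derivative_scaleR[OF this p] show ?thesis
    unfolding polar_def[abs_def] by (simp add: add.commute mult.assoc)
qed

text \<open>The determinant of \<open>x\<close> and \<open>rot90 u\<close> is x \<bullet> u, so only
  the support value of the boundary point survives.\<close>

lemma polar_det:
  "det (matrix (\<lambda>d. d $ 1 *\<^sub>R boundary_point K (z $ 2)
     + (z $ 1 * d $ 2 * \<rho> (z $ 2)) *\<^sub>R rot90 (unit_dir (z $ 2)))) = z $ 1 * (h (z $ 2) * \<rho> (z $ 2))"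
proof -
  have "det (matrix (\<lambda>d. d $ 1 *\<^sub>R x + (z $ 1 * d $ 2 * r) *\<^sub>R rot90 (unit_dir a))) = z $ 1 * ((x \<bullet> unit_dir a) * r)"
    for x :: "real^2" and r a
    by (simp add: det_2 matrix_def axis_def inner_2 algebra_simps)
  then show ?thesis by (simp only: boundary_point_inner)
qed

lemma Basis_real2: "(Basis :: (real^2) set) = {axis 1 1, axis 2 1}"
  by (auto simp: Basis_vec_def UNIV_2)

lemma has_integral_polar:
  "((\<lambda>z. \<bar>z $ 1 * (h (z $ 2) * \<rho> (z $ 2))\<bar>) has_integral mixed_area h (deriv h) h (deriv h)) polar_domain"
proof -
  interpret hh: smooth_support_pair h "deriv h" "deriv (deriv h)" h "deriv h" "deriv (deriv h)"
    by unfold_locales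
  let ?A = "mixed_area h (deriv h) h (deriv h)"
  \<comment> \<open>The indicators are built into the factors to make the integrand a product on the
    whole plane, where Tonelli applies. The radial factor integrates to 1/2, the angular one to
    twice the area.\<close>
  define F1 :: "real \<Rightarrow> real" where "F1 = (\<lambda>t. indicator {0<..1} t * t)"
  define F2 :: "real \<Rightarrow> real" where "F2 = (\<lambda>t. indicator {0..<2*pi} t * (h t * \<rho> t))"
  have nonneg: "0 \<le> F1 t" "0 \<le> F2 t" for t
    using h_pos[of t] \<rho>_pos[of t] by (auto simp: F1_def F2_def indicator_def)
  have [measurable]: "h \<in> borel_measurable borel" "\<rho> \<in> borel_measurable borel"
    by (auto intro!: borel_measurable_continuous_onI continuous continuous_\<rho>)
  have meas[measurable]: "F1 \<in> borel_measurable borel" "F2 \<in> borel_measurable borel"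
    unfolding F1_def F2_def by measurable
  have "((\<lambda>t::real. t) has_integral 1 / 2) {0..1}"
    using ident_has_integral[of 0 "1::real"] by simp
  then have "((\<lambda>t::real. t) has_integral 1 / 2) {0<..1}"
    by (simp only: has_integral_half_open)
  then have "(\<integral>\<^sup>+ t. ennreal (indicator {0<..1} t * t) \<partial>lborel) = ennreal (1 / 2)"
    by (intro nn_integral_has_integral_lebesgue) auto
  then have I1: "(\<integral>\<^sup>+ t. ennreal (F1 t) \<partial>lborel) = ennreal (1 / 2)"
    by (simp add: F1_def)
  have "((\<lambda>t. h t * \<rho> t) has_integral 2 * ?A) {0..2*pi}"
    using has_integral_mult_right[OF hh.has_integral_mixed, of 2] by (simp add: curvature_radius_def)
  then have "((\<lambda>t. h t * \<rho> t) has_integral 2 * ?A) {0..<2*pi}"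
    by (simp only: has_integral_half_open)
  then have "(\<integral>\<^sup>+ t. ennreal (indicator {0..<2*pi} t * (h t * \<rho> t)) \<partial>lborel) = ennreal (2 * ?A)"
    using h_pos \<rho>_pos by (intro nn_integral_has_integral_lebesgue) (auto simp: less_imp_le)
  then have I2: "(\<integral>\<^sup>+ t. ennreal (F2 t) \<partial>lborel) = ennreal (2 * ?A)"
    by (simp add: F2_def)
  define F where "F b = (if b = axis 1 1 then F1 else F2)" for b :: "real^2"
  have ax: "axis 2 1 \<noteq> (axis 1 1 :: real^2)" by (simp add: axis_eq_axis)
  have "(\<integral>\<^sup>+ z. (\<Prod>b\<in>Basis. ennreal (F b (z \<bullet> b))) \<partial>(lborel :: (real^2) measure)) = (\<Prod>b\<in>(Basis :: (real^2) set). \<integral>\<^sup>+ t. ennreal (F b t) \<partial>lborel)"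
    by (rule nn_integral_lborel_prod) (auto simp: F_def)
  then have "(\<integral>\<^sup>+ z. ennreal (F1 (z $ 1)) * ennreal (F2 (z $ 2)) \<partial>(lborel :: (real^2) measure)) = ennreal (1 / 2) * ennreal (2 * ?A)"
    using ax by (simp add: Basis_real2 F_def inner_axis I1 I2)
  then have I: "(\<integral>\<^sup>+ z. ennreal (F1 (z $ 1) * F2 (z $ 2)) \<partial>(lborel :: (real^2) measure)) = ennreal ?A"
    using hh.mixed_area_pos by (simp add: ennreal_mult'[symmetric] nonneg del: ennreal_half)
  have "((\<lambda>z. F1 (z $ 1) * F2 (z $ 2)) has_integral ?A) (UNIV :: (real^2) set)"
  proof (rule nn_integral_has_integral[OF _ _ I])
    have [measurable]: "(\<lambda>z::real^2. z $ i) \<in> borel_measurable borel" for i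
      by (intro borel_measurable_continuous_onI continuous_intros)
    show "(\<lambda>z::real^2. F1 (z $ 1) * F2 (z $ 2)) \<in> borel_measurable borel"
      by measurable
  qed (use nonneg hh.mixed_area_pos in \<open>auto simp: less_imp_le\<close>)
  moreover have "F1 (z $ 1) * F2 (z $ 2) = (if z \<in> polar_domain then \<bar>z $ 1 * (h (z $ 2) * \<rho> (z $ 2))\<bar> else 0)" for z :: "real^2"
    using h_pos[of "z $ 2"] \<rho>_pos[of "z $ 2"] by (auto simp: F1_def F2_def polar_domain_def abs_mult)
  ultimately show ?thesis
    using has_integral_restrict_UNIV by simp
qed

theorem vol_eq: "vol K = mixed_area h (deriv h) h (deriv h)"
proof -
  have [measurable]: "(\<lambda>z::real^2. z $ i) \<in> borel_measurable borel" for i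
    by (intro borel_measurable_continuous_onI continuous_intros)
  have "polar_domain \<in> sets borel"
    unfolding polar_domain_def by measurable
  then have "measure lebesgue (K - {0}) = mixed_area h (deriv h) h (deriv h)"
    using has_measure_differentiable_image[OF _ polar_deriv inj_on_polar] has_integral_polar
    unfolding polar_image polar_det by (blast intro: sets_completionI_sets lborelD)
  moreover have "measure lebesgue (K - {0}) = measure lebesgue K"
    using compact by (intro measure_Diff_null_set) (auto simp: negligible_iff_null_sets[symmetric] compact_imp_closed borel_closed sets_completionI_sets lborelD)
  ultimately show ?thesis unfolding vol_def by simp
qed

end

section \<open>Integration against the cone-volume measure\<close>

text \<open>Integrands are known only through the angle, while the measures live on the circle. As
  \<open>unit_dir\<close> maps the compact interval continuously onto the circle, preimages of
  closed sets are compact images; Borel measurability follows from this continuity.\<close>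

lemma continuous_on_sphereI:
  fixes f :: "real^2 \<Rightarrow> real"
  assumes "continuous_on {0..2*pi} (\<lambda>a. f (unit_dir a))"
  shows "continuous_on (sphere 0 1) f"
  unfolding continuous_on_closed_vimage[OF closed_sphere]
proof (intro allI impI)
  fix B :: "real set" assume B: "closed B"
  have "f -` B \<inter> sphere 0 1 = unit_dir ` ((\<lambda>a. f (unit_dir a)) -` B \<inter> {0..2*pi})"
  proof (intro equalityI subsetI)
    fix u assume "u \<in> f -` B \<inter> sphere 0 1"
    then obtain a where "a \<in> {0..<2*pi}" "u = unit_dir a" "f u \<in> B" using unit_dir_image by blast
    then show "u \<in> unit_dir ` ((\<lambda>a. f (unit_dir a)) -` B \<inter> {0..2*pi})" by auto
  qed auto
  moreover have "closed ((\<lambda>a. f (unit_dir a)) -` B \<inter> {0..2*pi})"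
    using assms B continuous_on_closed_vimage[of "{0..2*pi}" "\<lambda>a. f (unit_dir a)"] by simp
  then have "compact ((\<lambda>a. f (unit_dir a)) -` B \<inter> {0..2*pi})"
    using compact_Int_closed[of "{0..2*pi}" "(\<lambda>a. f (unit_dir a)) -` B \<inter> {0..2*pi}"]
    by (simp add: Int_commute Int_left_commute)
  then have "compact (unit_dir ` ((\<lambda>a. f (unit_dir a)) -` B \<inter> {0..2*pi}))"
    by (intro compact_continuous_image) (intro continuous_intros)
  ultimately show "closed (f -` B \<inter> sphere 0 1)" by (simp add: compact_imp_closed)
qed

context smooth_body
begin

lemma cone_volume_integral:
  fixes f :: "real^2 \<Rightarrow> real"
  assumes f: "continuous_on {0..2*pi} (\<lambda>a. f (unit_dir a))"
  shows "(\<integral>u. f u \<partial>cone_volume_measure K) = integral {0..2*pi} (\<lambda>a. f (unit_dir a) * (h a * \<rho> a / 2))"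
proof -
  let ?S = "restrict_space borel (sphere 0 (1::real)) :: (real^2) measure"
  let ?I = "restrict_space lborel {0..<2*pi}"
  have f_meas[measurable]: "f \<in> borel_measurable ?S"
    by (intro borel_measurable_continuous_on_restrict continuous_on_sphereI f)
  have "continuous_on {0..2*pi} (\<lambda>a. support_function K (unit_dir a))"
    using continuous(1) by (simp add: support_angle_def[abs_def])
  then have h_meas[measurable]: "support_function K \<in> borel_measurable ?S"
    by (intro borel_measurable_continuous_on_restrict continuous_on_sphereI)
  have [measurable]: "unit_dir \<in> borel_measurable borel"
    using continuous_unit_dir[OF continuous_on_id] by (intro borel_measurable_continuous_onI) auto
  have u_meas[measurable]: "unit_dir \<in> measurable ?I ?S"
    by (intro measurable_restrict_space3) (auto simp: norm_unit_dir)
  have "h \<in> borel_measurable borel" "\<rho> \<in> borel_measurable borel"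
    by (auto intro!: borel_measurable_continuous_onI continuous continuous_\<rho>)
  then have hI[measurable]: "h \<in> borel_measurable ?I" and \<rho>I[measurable]: "\<rho> \<in> borel_measurable ?I"
    by (auto intro!: measurable_restrict_space1)
  have surf: "surface_area_measure K = distr (density ?I (\<lambda>a. ennreal (\<rho> a))) ?S unit_dir"
    unfolding surface_area_measure_def curvature_radius_def ..
  have sets_surf: "sets (surface_area_measure K) = sets ?S" "space (surface_area_measure K) = space ?S"
    unfolding surf by simp_all
  have hf: "(\<lambda>u. (support_function K u / 2) *\<^sub>R f u) \<in> borel_measurable ?S" by measurable
  have pos: "0 \<le> support_function K u" if u: "u \<in> sphere 0 1" for u
  proof -
    obtain a where "u = unit_dir a" using u norm_1_unit_dir by auto
    then show ?thesis using h_pos[of a] by (simp add: support_angle_def)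
  qed
  have "(\<integral>u. f u \<partial>cone_volume_measure K) = (\<integral>u. (support_function K u / 2) *\<^sub>R f u \<partial>surface_area_measure K)"
    unfolding cone_volume_measure_def
  proof (rule integral_density)
    show "f \<in> borel_measurable (surface_area_measure K)"
      using f_meas by (simp add: measurable_cong_sets[OF sets_surf(1) refl])
    show "(\<lambda>u. support_function K u / 2) \<in> borel_measurable (surface_area_measure K)"
      unfolding measurable_cong_sets[OF sets_surf(1) refl] by measurable
    show "AE u in surface_area_measure K. 0 \<le> support_function K u / 2"
      using pos by (intro AE_I2) (simp add: sets_surf space_restrict_space)
  qed
  also have "\<dots> = (\<integral>a. (support_function K (unit_dir a) / 2) *\<^sub>R f (unit_dir a) \<partial>density ?I (\<lambda>a. ennreal (\<rho> a)))"
    unfolding surf by (rule integral_distr[OF _ hf]) simp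
  also have "\<dots> = (\<integral>a. \<rho> a *\<^sub>R ((support_function K (unit_dir a) / 2) *\<^sub>R f (unit_dir a)) \<partial>?I)"
  proof (rule integral_density)
    show "(\<lambda>a. (support_function K (unit_dir a) / 2) *\<^sub>R f (unit_dir a)) \<in> borel_measurable ?I"
      by (rule measurable_compose[OF u_meas hf])
    show "AE a in ?I. 0 \<le> \<rho> a" using \<rho>_pos by (intro AE_I2) (simp add: less_imp_le)
  qed (rule \<rho>I)
  also have "\<dots> = (\<integral>a. f (unit_dir a) * (h a * \<rho> a / 2) \<partial>?I)"
    by (intro Bochner_Integration.integral_cong) (simp_all add: support_angle_def)
  also have "\<dots> = (LINT a : {0..<2*pi} | lborel. f (unit_dir a) * (h a * \<rho> a / 2))"
    unfolding set_lebesgue_integral_def by (subst integral_restrict_space) auto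
  also have "\<dots> = integral {0..<2*pi} (\<lambda>a. f (unit_dir a) * (h a * \<rho> a / 2))"
  proof (rule set_borel_integral_eq_integral(2))
    have "set_integrable lborel {0..2*pi} (\<lambda>a. f (unit_dir a) * (h a * \<rho> a / 2))"
      by (intro borel_integrable_atLeastAtMost' continuous_on_mult continuous_on_divide f continuous continuous_\<rho>
          continuous_on_const) simp
    then show "set_integrable lborel {0..<2*pi} (\<lambda>a. f (unit_dir a) * (h a * \<rho> a / 2))"
      by (rule set_integrable_subset) auto
  qed
  also have "\<dots> = integral {0..2*pi} (\<lambda>a. f (unit_dir a) * (h a * \<rho> a / 2))"
    by (rule integral_spike_set; force intro: negligible_subset[OF negligible_sing[of "2*pi"]])
  finally show ?thesis .
qed

end

theorem curvature_entropy_eq: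
  assumes "smooth_body K" "smooth_body L"
  shows "curvature_entropy K L = integral {0..2*pi}
    (\<lambda>a. ln (curvature_radius L a / curvature_radius K a) * (support_angle K a * curvature_radius K a / 2))"
proof -
  interpret K: smooth_body K by fact
  interpret L: smooth_body L by fact
  have pos: "0 < curvature_radius K a" "0 < curvature_radius L a" for a
    by (rule K.\<rho>_pos, rule L.\<rho>_pos)
  have neq: "curvature_radius K a \<noteq> 0" "curvature_radius L a \<noteq> 0" for a
    using pos[of a] by simp_all
  \<comment> \<open>Passing from curvatures to radii inverts the quotient; the resulting sign
    cancels the minus in \<open>curvature_entropy\<close>.\<close>
  have eq: "ln (curvature L (unit_dir a) / curvature K (unit_dir a)) = - ln (curvature_radius L a / curvature_radius K a)" for a
    using pos[of a] by (simp add: K.curvature_unit_dir L.curvature_unit_dir ln_div)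
  have "continuous_on {0..2*pi} (\<lambda>a. ln (curvature L (unit_dir a) / curvature K (unit_dir a)))"
    unfolding eq
    by (intro continuous_on_minus continuous_on_ln continuous_on_divide K.continuous_\<rho> L.continuous_\<rho>)
      (simp_all add: neq)
  from K.cone_volume_integral[OF this] show ?thesis
    unfolding curvature_entropy_def eq by simp
qed

subsection \<open>Dilation position\<close>

definition homothet_fits :: "'a::euclidean_space set \<Rightarrow> 'a set \<Rightarrow> real \<Rightarrow> bool" where
  "homothet_fits K L t \<longleftrightarrow> 0 < t \<and> (\<exists>x. (\<lambda>y. x + t *\<^sub>R y) ` L \<subseteq> K)"

text \<open>\<open>GREATEST\<close> says nothing until the maximum is known to exist. It does
  because the pairs of factor and translation that fit form a compact set.\<close>

lemma relative_inradius_greatest: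
  fixes K L :: "'a::euclidean_space set"
  assumes K: "compact K" "0 \<in> interior K" and L: "bounded L" "0 \<in> L" "\<exists>y\<in>L. y \<noteq> 0"
  shows "homothet_fits K L (relative_inradius K L)"
    and "homothet_fits K L t \<Longrightarrow> t \<le> relative_inradius K L"
proof -
  define S where "S = {p :: real \<times> 'a. 0 \<le> fst p} \<inter> (\<Inter>y\<in>L. {p. snd p + fst p *\<^sub>R y \<in> K})"
  have fits: "homothet_fits K L t \<longleftrightarrow> 0 < t \<and> (\<exists>x. (t, x) \<in> S)" for t
    by (auto simp: homothet_fits_def S_def)
  have "closed {p :: real \<times> 'a. 0 \<le> fst p}"
    by (intro closed_Collect_le continuous_intros)
  moreover have "closed {p :: real \<times> 'a. snd p + fst p *\<^sub>R y \<in> K}" for y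
    using continuous_closed_vimage[of K "\<lambda>p :: real \<times> 'a. snd p + fst p *\<^sub>R y"] K(1)
    by (simp add: vimage_def compact_imp_closed)
  ultimately have "closed S" unfolding S_def by (intro closed_Int closed_INT) auto
  obtain B where B: "\<And>y. y \<in> K \<Longrightarrow> norm y \<le> B"
    using K(1) compact_imp_bounded bounded_iff by metis
  obtain y0 where y0: "y0 \<in> L" "y0 \<noteq> 0" using L(3) by blast
  have "S \<subseteq> {0..2 * B / norm y0} \<times> K"
  proof
    fix p assume p: "p \<in> S"
    obtain t x where tx: "p = (t, x)" by (cases p)
    have t: "0 \<le> t" and xy: "\<And>y. y \<in> L \<Longrightarrow> x + t *\<^sub>R y \<in> K" using p by (auto simp: S_def tx)
    have x: "x \<in> K" using xy[OF L(2)] by simp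
    have "t * norm y0 = norm ((x + t *\<^sub>R y0) - x)" using t by simp
    also have "\<dots> \<le> norm (x + t *\<^sub>R y0) + norm x" by (rule norm_triangle_ineq4)
    also have "\<dots> \<le> 2 * B" using B[OF x] B[OF xy[OF y0(1)]] by simp
    finally show "p \<in> {0..2 * B / norm y0} \<times> K" using t x y0 by (simp add: tx pos_le_divide_eq)
  qed
  then have "bounded S"
    by (rule bounded_subset[rotated]) (intro bounded_Times compact_imp_bounded K(1) compact_Icc)
  with \<open>closed S\<close> have "compact S" by (simp add: compact_eq_bounded_closed)
  obtain e where e: "0 < e" "cball 0 e \<subseteq> K" using K(2) by (meson mem_interior_cball)
  obtain C where C: "0 < C" "\<And>y. y \<in> L \<Longrightarrow> norm y \<le> C" using L(1) bounded_pos by metis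
  \<comment> \<open>\<open>K\<close> contains the ball of radius \<open>e\<close> and
    \<open>L\<close> lies in the ball of radius \<open>C\<close>, so \<open>e / C\<close> fits
    without translation.\<close>
  have S0: "(e / C, 0) \<in> S"
  proof -
    have "e / C * norm y \<le> e" if "y \<in> L" for y
      using mult_left_mono[OF C(2)[OF that], of "e / C"] e(1) C(1) by simp
    then show ?thesis using e C(1) by (auto simp: S_def subset_iff)
  qed
  then have "S \<noteq> {}" by blast
  moreover have "continuous_on S fst" by (intro continuous_intros)
  ultimately obtain p where p: "p \<in> S" "\<And>q. q \<in> S \<Longrightarrow> fst q \<le> fst p"
    using continuous_attains_sup[OF \<open>compact S\<close>, of fst] by blast
  have "0 < e / C" using e C by simp
  then have "0 < fst p" using p(2)[OF S0] by simp
  then have 1: "homothet_fits K L (fst p)"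
    unfolding fits using p(1) by (intro conjI exI[of _ "snd p"]) auto
  have 2: "t \<le> fst p" if t: "homothet_fits K L t" for t
  proof -
    obtain x where "(t, x) \<in> S" using t unfolding fits by blast
    then show ?thesis using p(2) by force
  qed
  have "relative_inradius K L = fst p"
    unfolding relative_inradius_def homothet_fits_def[symmetric] by (rule Greatest_equality) (rule 1, erule 2)
  with 1 2 show "homothet_fits K L (relative_inradius K L)"
    and "homothet_fits K L t \<Longrightarrow> t \<le> relative_inradius K L" by simp_all
qed

lemma subset_homothet_iff:
  fixes K L :: "'a::real_vector set"
  assumes "0 < t"
  shows "K \<subseteq> (\<lambda>y. x + t *\<^sub>R y) ` L \<longleftrightarrow> (\<lambda>y. (- 1 / t) *\<^sub>R x + (1 / t) *\<^sub>R y) ` K \<subseteq> L"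
proof -
  have inv: "x + t *\<^sub>R ((- 1 / t) *\<^sub>R x + (1 / t) *\<^sub>R y) = y"
    "(- 1 / t) *\<^sub>R x + (1 / t) *\<^sub>R (x + t *\<^sub>R y) = y" for y
    using assms by (simp_all add: scaleR_right_distrib scaleR_diff_right)
  show ?thesis
  proof
    assume "K \<subseteq> (\<lambda>y. x + t *\<^sub>R y) ` L"
    then show "(\<lambda>y. (- 1 / t) *\<^sub>R x + (1 / t) *\<^sub>R y) ` K \<subseteq> L" using inv(2) by fastforce
  next
    assume *: "(\<lambda>y. (- 1 / t) *\<^sub>R x + (1 / t) *\<^sub>R y) ` K \<subseteq> L"
    show "K \<subseteq> (\<lambda>y. x + t *\<^sub>R y) ` L"
    proof
      fix y assume "y \<in> K"
      then have "(- 1 / t) *\<^sub>R x + (1 / t) *\<^sub>R y \<in> L" using * by blast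
      then show "y \<in> (\<lambda>y. x + t *\<^sub>R y) ` L" by (rule image_eqI[rotated]) (simp only: inv)
    qed
  qed
qed

text \<open>Inverting a homothety turns covering into fitting, so every fact about the inradius
  transfers to the circumradius with the bodies swapped.\<close>

lemma relative_circumradius_eq:
  fixes K L :: "'a::euclidean_space set"
  assumes L: "compact L" "0 \<in> interior L" and K: "bounded K" "0 \<in> K" "\<exists>y\<in>K. y \<noteq> 0"
  shows "relative_circumradius K L = 1 / relative_inradius L K"
proof -
  note greatest = relative_inradius_greatest[OF L K]
  have iff: "0 < t \<and> (\<exists>x. K \<subseteq> (\<lambda>y. x + t *\<^sub>R y) ` L) \<longleftrightarrow> homothet_fits L K (1 / t)" for t
  proof (cases "0 < t")
    case True
    have "(\<exists>x. (\<lambda>y. (- 1 / t) *\<^sub>R x + (1 / t) *\<^sub>R y) ` K \<subseteq> L) \<longleftrightarrow> (\<exists>x. (\<lambda>y. x + (1 / t) *\<^sub>R y) ` K \<subseteq> L)"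
    proof
      assume "\<exists>x. (\<lambda>y. x + (1 / t) *\<^sub>R y) ` K \<subseteq> L"
      then obtain x where x: "(\<lambda>y. x + (1 / t) *\<^sub>R y) ` K \<subseteq> L" by blast
      have "(- 1 / t) *\<^sub>R (- t *\<^sub>R x) = x" using True by simp
      then show "\<exists>x. (\<lambda>y. (- 1 / t) *\<^sub>R x + (1 / t) *\<^sub>R y) ` K \<subseteq> L"
        using x by (intro exI[of _ "- t *\<^sub>R x"]) (simp only:)
    qed blast
    then show ?thesis using True by (simp only: subset_homothet_iff homothet_fits_def) simp
  qed (simp add: homothet_fits_def)
  let ?r = "relative_inradius L K"
  have r: "0 < ?r" using greatest(1) by (simp add: homothet_fits_def)
  show ?thesis
    unfolding relative_circumradius_def iff
  proof (rule Least_equality)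
    show "homothet_fits L K (1 / (1 / ?r))" using greatest(1) by simp
    fix t assume t: "homothet_fits L K (1 / t)"
    then have "0 < t" by (simp add: homothet_fits_def)
    then show "1 / ?r \<le> t" using greatest(2)[OF t] r by (simp add: field_simps)
  qed
qed

section \<open>Contact directions of an extremal homothet\<close>

lemma mem_of_support_angle:
  fixes K :: "(real^2) set"
  assumes K: "compact K" "convex K" "K \<noteq> {}" and z: "\<And>a. z \<bullet> unit_dir a \<le> support_angle K a"
  shows "z \<in> K"
proof (rule ccontr)
  assume "z \<notin> K"
  then obtain c b where cb: "c \<bullet> z < b" "\<And>x. x \<in> K \<Longrightarrow> b < c \<bullet> x"
    using separating_hyperplane_closed_point[OF K(2) compact_imp_closed[OF K(1)]] by blast
  have c: "c \<noteq> 0" using cb K(3) by force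
  then obtain a where a: "(- 1 / norm c) *\<^sub>R c = unit_dir a"
    using norm_1_unit_dir[of "(- 1 / norm c) *\<^sub>R c"] by auto
  have "support_function K (unit_dir a) \<le> - b / norm c"
  proof (rule support_function_le[OF K(3)])
    fix y assume "y \<in> K"
    then have "b / norm c \<le> (c \<bullet> y) / norm c"
      using cb(2) by (intro divide_right_mono) (auto simp: less_imp_le)
    then show "unit_dir a \<bullet> y \<le> - b / norm c" by (simp add: a[symmetric])
  qed
  moreover have "z \<bullet> unit_dir a > - b / norm c"
    using cb(1) c by (simp add: a[symmetric] inner_commute divide_strict_right_mono)
  ultimately show False using z[of a] by (simp add: support_angle_def)
qed

lemma unit_dir_inner: "unit_dir a \<bullet> unit_dir b = cos (b - a)"
  by (simp add: inner_2 cos_diff mult.commute)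

text \<open>If the contact directions left out a closed half circle, then translating away from it would
  free \<open>L\<close> from all contacts and leave room for a larger homothet.\<close>

lemma contact_directions:
  assumes bodies: "smooth_body K" "smooth_body L"
    and r: "0 < r" and le: "\<And>a. r * support_angle L a \<le> support_angle K a"
    and max: "\<And>t. homothet_fits K L t \<Longrightarrow> t \<le> r"
  shows "\<exists>a\<in>{b..b + pi}. support_angle K a = r * support_angle L a"
proof (rule ccontr)
  assume no_contact: "\<not> (\<exists>a\<in>{b..b + pi}. support_angle K a = r * support_angle L a)"
  interpret K: smooth_body K by fact
  interpret L: smooth_body L by fact
  let ?hK = "support_angle K" and ?hL = "support_angle L"
  define g where "g a = ?hK a - r * ?hL a" for a
  have cont_g: "continuous_on S g" for S
    unfolding g_def by (intro continuous_on_diff continuous_on_mult continuous_on_const K.continuous L.continuous)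
  have g_pos: "0 < g a" if "a \<in> {b..b + pi}" for a
    using no_contact that le[of a] by (force simp: g_def less_le)
  obtain a0 where a0: "a0 \<in> {b..b + pi}" "\<And>a. a \<in> {b..b + pi} \<Longrightarrow> g a0 \<le> g a"
    using continuous_attains_inf[OF compact_Icc _ cont_g, of b "b + pi"] by auto
  \<comment> \<open>Half the least gap on the contact-free half circle: a shift of this length
    cannot close the gap there.\<close>
  define \<epsilon> where "\<epsilon> = g a0 / 2"
  have \<epsilon>: "0 < \<epsilon>" using g_pos[OF a0(1)] by (simp add: \<epsilon>_def)
  \<comment> \<open>The midpoint of the complementary open half circle, on which the cosine around
    \<open>m\<close> is positive.\<close>
  define m where "m = b + 3 * pi / 2"
  \<comment> \<open>The gap between \<open>K\<close> and \<open>r L\<close> after translating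
    \<open>r L\<close> by \<open>- \<epsilon> *\<^sub>R unit_dir m\<close>.\<close>
  define G where "G a = g a + \<epsilon> * cos (a - m)" for a
  have cont_G: "continuous_on S G" for S
    unfolding G_def by (intro continuous_intros cont_g)
  have G_per: "G (a + 2 * pi) = G a" for a
  proof -
    have "a + 2 * pi - m = (a - m) + 2 * pi" by simp
    then show ?thesis by (simp only: G_def g_def K.periodic_h L.periodic_h cos_periodic)
  qed
  have G_pos: "0 < G a" if a: "a \<in> {b..<b + 2 * pi}" for a
  proof (cases "a \<in> {b..b + pi}")
    case True
    have "\<epsilon> * (- 1) \<le> \<epsilon> * cos (a - m)" using \<epsilon> by (intro mult_left_mono) auto
    then show ?thesis using a0(2)[OF True] \<epsilon> by (simp add: G_def \<epsilon>_def)
  next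
    case False
    then have "0 < cos (a - m)"
      using a by (intro cos_gt_zero_pi) (auto simp: m_def)
    then show ?thesis using le[of a] \<epsilon> by (simp add: G_def g_def add_nonneg_pos)
  qed
  then have G_pos: "0 < G a" if a: "a \<in> {b..b + 2 * pi}" for a
    using a G_per[of b] by (cases "a = b + 2 * pi") auto
  obtain a1 where a1: "a1 \<in> {b..b + 2 * pi}" "\<And>a. a \<in> {b..b + 2 * pi} \<Longrightarrow> G a1 \<le> G a"
    using continuous_attains_inf[OF compact_Icc _ cont_G, of b "b + 2 * pi"] by auto
  define \<delta> where "\<delta> = G a1"
  have \<delta>: "0 < \<delta>" using G_pos[OF a1(1)] by (simp add: \<delta>_def)
  have G_ge: "\<delta> \<le> G a" for a
  proof -
    obtain k :: int where k: "a + 2 * pi * of_int k \<in> {b..<b + 2 * pi}"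
      using exists_period_shift[of "2 * pi" a b] by auto
    have "G (a + 2 * pi * of_int k) = G a" by (rule periodic_int_shift) (rule G_per)
    then show ?thesis using a1(2)[of "a + 2 * pi * of_int k"] k by (simp add: \<delta>_def)
  qed
  obtain M where M: "0 < M" "\<And>y. y \<in> L \<Longrightarrow> norm y \<le> M"
    using compact_imp_bounded[OF L.compact] bounded_pos by metis
  have K_ne: "K \<noteq> {}" "L \<noteq> {}" using K.zero_interior L.zero_interior interior_subset by blast+
  have hL_le: "?hL a \<le> M" for a
    unfolding support_angle_def
  proof (rule support_function_le[OF K_ne(2)])
    fix y assume "y \<in> L"
    then show "unit_dir a \<bullet> y \<le> M"
      using norm_cauchy_schwarz[of "unit_dir a" y] M(2)[of y] by simp
  qed
  \<comment> \<open>The support values of \<open>L\<close> are at most \<open>M\<close>, so this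
    increase of the factor uses up at most the gap \<open>\<delta>\<close>.\<close>
  define t where "t = r + \<delta> / M"
  have t: "0 < t" "r < t" using r \<delta> M by (auto simp: t_def add_pos_pos)
  have "(- \<epsilon>) *\<^sub>R unit_dir m + t *\<^sub>R y \<in> K" if y: "y \<in> L" for y
  proof (rule mem_of_support_angle[OF K.compact K.convex K_ne(1)])
    fix a
    have "((- \<epsilon>) *\<^sub>R unit_dir m + t *\<^sub>R y) \<bullet> unit_dir a = t * (y \<bullet> unit_dir a) - \<epsilon> * cos (a - m)"
      by (simp add: inner_diff_left unit_dir_inner)
    also have "\<dots> \<le> t * ?hL a - \<epsilon> * cos (a - m)"
      using t L.support_ge[OF y] by simp
    also have "\<dots> = r * ?hL a + \<delta> / M * ?hL a - \<epsilon> * cos (a - m)"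
      by (simp add: t_def distrib_right)
    also have "\<dots> \<le> r * ?hL a + \<delta> / M * M - \<epsilon> * cos (a - m)"
      using hL_le[of a] \<delta> M by (intro diff_right_mono add_left_mono mult_left_mono) auto
    also have "\<dots> \<le> ?hK a"
      using G_ge[of a] M by (simp add: G_def g_def)
    finally show "((- \<epsilon>) *\<^sub>R unit_dir m + t *\<^sub>R y) \<bullet> unit_dir a \<le> ?hK a" .
  qed
  then have "homothet_fits K L t" unfolding homothet_fits_def using t by blast
  then show False using max[of t] t by simp
qed

lemma support_angle_le_of_homothet:
  assumes bodies: "smooth_body K" "smooth_body L" and r: "0 < r" and sub: "(\<lambda>y. r *\<^sub>R y) ` L \<subseteq> K"
  shows "r * support_angle L a \<le> support_angle K a"
proof -
  interpret K: smooth_body K by fact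
  interpret L: smooth_body L by fact
  have "support_function L (unit_dir a) \<le> support_angle K a / r"
  proof (rule support_function_le)
    show "L \<noteq> {}" using L.zero_interior interior_subset by blast
    fix y assume "y \<in> L"
    then have "(r *\<^sub>R y) \<bullet> unit_dir a \<le> support_angle K a"
      using sub by (intro K.support_ge) blast
    then show "unit_dir a \<bullet> y \<le> support_angle K a / r"
      using r by (simp add: inner_commute pos_le_divide_eq mult.commute)
  qed
  then show ?thesis using r by (simp add: support_angle_def pos_le_divide_eq mult.commute)
qed

section \<open>Equality case and conclusion\<close>

text \<open>The translation adds x \<bullet> u to the support function, and this term is annihilated
  by h + h''. The radii of curvature thus have the constant ratio \<open>c\<close>, while the areas
  have ratio c^2, which accounts for the factor 1/2.\<close>

lemma entropy_homothetic:
  assumes bodies: "smooth_body K" "smooth_body L" and "homothetic K L"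
  shows "curvature_entropy K L = vol K / 2 * ln (vol L / vol K)"
proof -
  interpret K: smooth_body K by fact
  interpret L: smooth_body L by fact
  interpret KK: smooth_support_pair "support_angle K" "deriv (support_angle K)" "deriv (deriv (support_angle K))"
    "support_angle K" "deriv (support_angle K)" "deriv (deriv (support_angle K))" by unfold_locales
  interpret LL: smooth_support_pair "support_angle L" "deriv (support_angle L)" "deriv (deriv (support_angle L))"
    "support_angle L" "deriv (support_angle L)" "deriv (deriv (support_angle L))" by unfold_locales
  have vol_pos: "0 < vol K" "0 < vol L"
    unfolding K.vol_eq L.vol_eq by (rule KK.mixed_area_pos, rule LL.mixed_area_pos)
  obtain c x where c: "0 < c" and K: "K = (\<lambda>y. c *\<^sub>R y + x) ` L"
    using assms(3) unfolding homothetic_def by blast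
  have "measure lebesgue K = \<bar>c\<bar> ^ DIM(real^2) * measure lebesgue L"
    unfolding K by (rule measure_lebesgue_affine)
  then have vol: "vol K = c\<^sup>2 * vol L" by (simp add: vol_def)
  have h: "support_angle K a = c * support_angle L a + x \<bullet> unit_dir a" for a
  proof (rule antisym)
    show "support_angle K a \<le> c * support_angle L a + x \<bullet> unit_dir a"
      unfolding support_angle_def[of K]
    proof (rule support_function_le)
      show "K \<noteq> {}" using K.zero_interior interior_subset by blast
      fix y assume "y \<in> K"
      then obtain z where z: "z \<in> L" "y = c *\<^sub>R z + x" using K by blast
      have "unit_dir a \<bullet> y = c * (z \<bullet> unit_dir a) + x \<bullet> unit_dir a"
        by (simp add: z inner_right_distrib inner_commute)
      also have "\<dots> \<le> c * support_angle L a + x \<bullet> unit_dir a"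
        using L.support_ge[OF z(1)] c by simp
      finally show "unit_dir a \<bullet> y \<le> c * support_angle L a + x \<bullet> unit_dir a" .
    qed
    have "c *\<^sub>R boundary_point L a + x \<in> K" using K L.boundary_point_in by blast
    from K.support_ge[OF this, of a] show "c * support_angle L a + x \<bullet> unit_dir a \<le> support_angle K a"
      by (simp add: inner_left_distrib L.boundary_point_inner)
  qed
  have d1: "((\<lambda>a. x \<bullet> unit_dir a) has_real_derivative x \<bullet> rot90 (unit_dir a)) (at a)" for a
    unfolding has_real_derivative_iff_has_vector_derivative
    by (rule bounded_linear.has_vector_derivative[OF bounded_linear_inner_right unit_dir_deriv])
  have d2: "((\<lambda>a. x \<bullet> rot90 (unit_dir a)) has_real_derivative x \<bullet> (- unit_dir a)) (at a)" for a
    unfolding has_real_derivative_iff_has_vector_derivative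
    by (rule bounded_linear.has_vector_derivative[OF bounded_linear_inner_right rot90_unit_dir_deriv])
  have h1: "deriv (support_angle K) = (\<lambda>a. c * deriv (support_angle L) a + x \<bullet> rot90 (unit_dir a))"
    unfolding h[abs_def]
    by (intro ext DERIV_imp_deriv DERIV_add DERIV_cmult L.DERIV_h d1)
  have h2: "deriv (deriv (support_angle K)) = (\<lambda>a. c * deriv (deriv (support_angle L)) a + x \<bullet> (- unit_dir a))"
    unfolding h1
    by (intro ext DERIV_imp_deriv DERIV_add DERIV_cmult L.DERIV_h1 d2)
  have \<rho>: "curvature_radius K a = c * curvature_radius L a" for a
    unfolding curvature_radius_def h2 h by (simp add: distrib_left)
  have ln_eq: "ln (curvature_radius L a / curvature_radius K a) = - ln c" for a
    using c L.\<rho>_pos[of a] by (simp add: \<rho> ln_div ln_mult)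
  have "curvature_entropy K L = integral {0..2*pi} (\<lambda>a. - ln c * (support_angle K a * curvature_radius K a / 2))"
    unfolding curvature_entropy_eq[OF bodies] ln_eq ..
  also have "\<dots> = - ln c * vol K"
    unfolding K.vol_eq curvature_radius_def
    by (intro integral_unique has_integral_mult_right KK.has_integral_mixed)
  also have "\<dots> = vol K / 2 * ln (vol L / vol K)"
    using c vol_pos by (simp add: vol ln_div ln_mult ln_realpow)
  finally show ?thesis .
qed

theorem theorem1:
  fixes K L :: "(real^2) set"
  assumes "convex_body K" and "convex_body L"
    and "smooth_boundary K" and "smooth_boundary L"
    and "strictly_convex K" and "strictly_convex L"
    and "positive_curvature K" and "positive_curvature L"
    and "0 \<in> interior K" and "0 \<in> interior L"
    and "dilation_position K L"
  shows "curvature_entropy K L \<le> vol K / 2 * ln (vol L / vol K) \<and>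
         (curvature_entropy K L = vol K / 2 * ln (vol L / vol K) \<longleftrightarrow> homothetic K L)"
proof -
  have bodies: "smooth_body K" "smooth_body L"
    using assms by (auto simp: smooth_body_def convex_body_def)
  interpret K: smooth_body K by fact
  interpret L: smooth_body L by fact
  interpret KL: smooth_support_pair "support_angle K" "deriv (support_angle K)" "deriv (deriv (support_angle K))"
    "support_angle L" "deriv (support_angle L)" "deriv (deriv (support_angle L))" by unfold_locales
  define r where "r = relative_inradius K L"
  \<comment> \<open>The inradius with the bodies swapped; the circumradius is its
    reciprocal.\<close>
  define s where "s = relative_inradius L K"
  have in_bodies: "0 \<in> K" "0 \<in> L" using assms(9,10) interior_subset by blast+
  have nonzero: "\<exists>y\<in>M. y \<noteq> 0" if M: "0 \<in> interior M" for M :: "(real^2) set"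
  proof -
    obtain e where e: "0 < e" "cball 0 e \<subseteq> M" using M by (meson mem_interior_cball)
    have "e *\<^sub>R unit_dir 0 \<in> cball 0 e" using e(1) by simp
    moreover have "norm (e *\<^sub>R unit_dir 0) \<noteq> 0" using e(1) by simp
    then have "e *\<^sub>R unit_dir 0 \<noteq> 0" by (simp only: norm_eq_zero not_False_eq_True)
    ultimately show ?thesis using e(2) by blast
  qed
  note fits_r = relative_inradius_greatest[OF K.compact K.zero_interior compact_imp_bounded[OF L.compact]
      in_bodies(2) nonzero[OF L.zero_interior], folded r_def]
  note fits_s = relative_inradius_greatest[OF L.compact L.zero_interior compact_imp_bounded[OF K.compact]
      in_bodies(1) nonzero[OF K.zero_interior], folded s_def]
  have R: "relative_circumradius K L = 1 / s"
    unfolding s_def by (rule relative_circumradius_eq[OF L.compact L.zero_interior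
          compact_imp_bounded[OF K.compact] in_bodies(1) nonzero[OF K.zero_interior]])
  have pos: "0 < r" "0 < s" using fits_r(1) fits_s(1) by (auto simp: homothet_fits_def)
  \<comment> \<open>Dilation position removes the translations, so both inclusions compare support
    functions about the same origin.\<close>
  have sub_r: "(\<lambda>y. r *\<^sub>R y) ` L \<subseteq> K" and sub_R: "K \<subseteq> (\<lambda>y. (1 / s) *\<^sub>R y) ` L"
    using assms(11) by (simp_all add: dilation_position_def r_def R)
  have sub_s: "(\<lambda>y. s *\<^sub>R y) ` K \<subseteq> L" using sub_R pos by fastforce
  note le_r = support_angle_le_of_homothet[OF bodies pos(1) sub_r]
  note le_s = support_angle_le_of_homothet[OF bodies(2,1) pos(2) sub_s]
  have le_R: "support_angle K a \<le> 1 / s * support_angle L a" for a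
    using le_s[of a] pos by (simp add: field_simps)
  have contact_r: "\<exists>a\<in>{b..b + pi}. support_angle K a = r * support_angle L a" for b
    by (rule contact_directions[OF bodies pos(1) le_r fits_r(2)])
  have contact_R: "\<exists>a\<in>{b..b + pi}. support_angle K a = 1 / s * support_angle L a" for b
    using contact_directions[OF bodies(2,1) pos(2) le_s fits_s(2), of b] pos by (force simp: field_simps)
  note bound = KL.entropy_bound[OF pos(1) le_r le_R contact_r contact_R,
      folded curvature_radius_def K.vol_eq L.vol_eq, folded curvature_entropy_eq[OF bodies]]
  show ?thesis
  proof (intro conjI iffI)
    assume "curvature_entropy K L = vol K / 2 * ln (vol L / vol K)"
    \<comment> \<open>Equality contradicts the strict bound unless the two radii coincide; the
      inclusions then squeeze \<open>K\<close> onto \<open>r L\<close>, with no translation.\<close>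
    then have "1 / s \<le> r" using bound(2) by linarith
    moreover have "r * support_angle L 0 \<le> 1 / s * support_angle L 0"
      using le_r[of 0] le_R[of 0] by linarith
    then have "r \<le> 1 / s" using L.h_pos[of 0] by (simp only: mult_le_cancel_right_pos)
    ultimately have "1 / s = r" by simp
    then have "K = (\<lambda>y. r *\<^sub>R y + 0) ` L" using sub_r sub_R by auto
    then show "homothetic K L" using pos(1) unfolding homothetic_def by blast
  qed (rule bound(1), rule entropy_homothetic[OF bodies])
qed

end
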